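(* Let $z$ be an interior vertex of the triangulation $\mathcal{T}_h$, with control volume $C^z$. Let $u_h$ be the SUPG/CGFEM solution, and on each element $\tau$ having $z$ as a vertex let $\widetilde u_{\tau,h}\in V(\tau)$ be a solution of the elemental Neumann problem; set $\widetilde{\boldsymbol{\nu}}_h=-k\nabla\widetilde u_{\tau,h}+u_h\boldsymbol{v}$ on $\tau$. Then the local conservation property $$\int_{\partial C^z}\widetilde{\boldsymbol{\nu}}_h\cdot\boldsymbol{n}\,dl=\int_{C^z}f\,d\boldsymbol{x}$$ holds.
   Context: Setting. $\Omega\subset\mathbb{R}^2$ is a bounded polygonal open domain with Lipschitz boundary; $k$ is a scalar coefficient with $0<k_{\min}\le k\le k_{\max}$ on $\Omega$; $\boldsymbol{v}$ is a vector field with $\nabla\cdot\boldsymbol{v}\ge 0$; $f$ and $g$ are given functions; all are regular enough that the integrals below make sense. The underlying problem is $\nabla\cdot(-k\nabla u+\boldsymbol{v}u)=f$ in $\Omega$, $u=g$ on $\partial\Omega$. $\mathcal{T}_h$ is a conforming triangulation of $\overline\Omega$ into triangles $\tau$. SUPG/CGFEM. $V_h$ is the space of continuous functions on $\overline\Omega$ that are linear on each $\tau$ and vanish on $\partial\Omega$. $g_h$ is the continuous piecewise linear interpolant of $g$. For each $\tau$, put $$a_\tau(u,w)=\int_\tau (k\nabla u-u\boldsymbol{v})\cdot\nabla w\,d\boldsymbol{x}+\int_\tau\delta\,\big(\nabla\cdot(-k\nabla u+\boldsymbol{v}u)\big)(\boldsymbol{v}\cdot\nabla w)\,d\boldsymbol{x},\qquad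 \ell_\tau(w)=\int_\tau f\,(w+\delta\,\boldsymbol{v}\cdot\nabla w)\,d\boldsymbol{x},$$ and $a=\sum_\tau a_\tau$, $\ell=\sum_\tau\ell_\tau$ (second derivatives of $u_h$ are taken elementwise). The solution $u_h$ satisfies $u_h-g_h\in V_h$ and $a(u_h,w_h)=\ell(w_h)$ for all $w_h\in V_h$. Here $\delta\ge0$ is the SUPG stabilization parameter ($\delta=0$ gives CGFEM). Dual mesh. For a triangle $\tau$ with vertex set $v(\tau)$, $\tau$ is split into three non-overlapping quadrilaterals $t_\xi$, $\xi\in v(\tau)$, by joining the barycenter of $\tau$ to the midpoints of its three edges; $t_\xi$ is the one containing $\xi$. The control volume $C^\xi$ is the union of the quadrilaterals $t_\xi$ over all elements having $\xi$ as a vertex, so $\partial C^\xi\cap\partial t_\xi$ consists of the two segments from the barycenter of $\tau$ to edge midpoints (for a boundary vertex $\xi$ it denotes only these two segments), and $\partial t_\xi=(\partial\tau\cap\partial t_\xi)\cup(\partial C^\xi\cap\partial t_\xi)$. $\boldsymbol{n}$ is the outward unit normal. Elemental Neumann problem. $\phi_\xi$ are the linear nodal basis functions on $\tau$, $V(\tau)=\mathrm{span}\{\phi_\xi:\xi\in v(\tau)\}$, $F^\xi=\ell_\tau(\phi_\xi)$, $Q^\xi=a_\tau(u_h,\phi_\xi)$. One seeks $\widetilde u_{\tau,h}\in V(\tau)$ such that for all $\xi\in v(\tau)$ the balance $\int_{\partial t_\xi}(-k\nabla\widetilde u_{\tau,h}+u_h\boldsymbol{v})\cdot\boldsymbol{n}\,dl=\int_{t_\xi}f\,d\boldsymbol{x}$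 holds, where the part of the flux on $\partial\tau$ is prescribed by the Neumann condition $\int_{\partial\tau\cap\partial t_\xi}(-k\nabla\widetilde u_{\tau,h}+u_h\boldsymbol{v})\cdot\boldsymbol{n}\,dl=F^\xi-Q^\xi$. Imposing the boundary condition by substitution into the balance, this is the system $$-\int_{\partial C^\xi\cap\partial t_\xi}k\nabla\widetilde u_{\tau,h}\cdot\boldsymbol{n}\,dl=Q^\xi-F^\xi+\int_{t_\xi}f\,d\boldsymbol{x}-\int_{\partial C^\xi\cap\partial t_\xi}u_h\boldsymbol{v}\cdot\boldsymbol{n}\,dl\qquad\forall\,\xi\in v(\tau).$$ *)

theory Defs
  imports "HOL-Analysis.Analysis"
begin

type_synonym point = "real^2"

section \<open>Differential operators\<close>

definition grad :: "(point \<Rightarrow> real) \<Rightarrow> point \<Rightarrow> point" where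
  "grad u x = (THE D. GDERIV u x :> D)"

definition divergence :: "(point \<Rightarrow> point) \<Rightarrow> point \<Rightarrow> real" where
  "divergence F x = trace (jacobian F (at x))"


section \<open>Integrals along polygonal curves\<close>

text \<open>Integration over a segment with respect to arc length.\<close>

definition segment_integral :: "point \<Rightarrow> point \<Rightarrow> (point \<Rightarrow> real) \<Rightarrow> real" where
  "segment_integral a b h = dist a b * (LINT t:{0..1}|lebesgue. h (a + t *\<^sub>R (b - a)))"

definition segment_integrable :: "point \<Rightarrow> point \<Rightarrow> (point \<Rightarrow> real) \<Rightarrow> bool" where
  "segment_integrable a b h \<longleftrightarrow> set_integrable lebesgue {0..1} (\<lambda>t. h (a + t *\<^sub>R (b - a)))"

text \<open>
  The arc length integral of \<open>h\<close> over a point set \<open>S\<close> that is a finite union of segments.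
  The segments may overlap only in finitely many points, so that \<open>I\<close> does not depend on how
  \<open>S\<close> is cut into segments (nor on their orientations).
\<close>

definition has_line_integral :: "(point \<Rightarrow> real) \<Rightarrow> real \<Rightarrow> point set \<Rightarrow> bool" where
  "has_line_integral h I S \<longleftrightarrow>
     (\<exists>E :: (point \<times> point) set.
        finite E \<and>
        (\<forall>(a, b) \<in> E. a \<noteq> b \<and> segment_integrable a b h) \<and>
        (\<forall>(a, b) \<in> E. \<forall>(c, d) \<in> E.
           (a, b) \<noteq> (c, d) \<longrightarrow> finite (closed_segment a b \<inter> closed_segment c d)) \<and>
        S = (\<Union>(a, b) \<in> E. closed_segment a b) \<and>
        I = (\<Sum>(a, b) \<in> E. segment_integral a b h))"

text \<open>
  Outward unit normal of a closed polygonal region: near \<open>x\<close> the region is the half plane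
  \<open>{y. (y - x) \<bullet> n \<le> 0}\<close>. This determines \<open>n\<close> at every boundary point except the corners,
  where the value is unspecified (and irrelevant for line integrals).
\<close>

definition outward_normal :: "point set \<Rightarrow> point \<Rightarrow> point" where
  "outward_normal C x =
     (THE n. norm n = 1 \<and>
        (\<exists>\<epsilon>>0. C \<inter> ball x \<epsilon> = {y \<in> ball x \<epsilon>. (y - x) \<bullet> n \<le> 0}))"


section \<open>Domain and triangulation\<close>

text \<open>
  Near each boundary point the domain is, in suitable orthonormal coordinates
  \<open>((y - p) \<bullet> d, (y - p) \<bullet> e)\<close>, the part lying strictly above the graph of a Lipschitz function.
\<close>

definition lipschitz_boundary :: "point set \<Rightarrow> bool" where
  "lipschitz_boundary \<Omega> \<longleftrightarrow>
     (\<forall>p \<in> frontier \<Omega>. \<exists>d e r L (\<gamma> :: real \<Rightarrow> real).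
        norm d = 1 \<and> norm e = 1 \<and> d \<bullet> e = 0 \<and> r > 0 \<and> L-lipschitz_on UNIV \<gamma> \<and>
        \<Omega> \<inter> ball p r = {y \<in> ball p r. \<gamma> ((y - p) \<bullet> d) < (y - p) \<bullet> e})"

definition polygonal_boundary :: "point set \<Rightarrow> bool" where
  "polygonal_boundary \<Omega> \<longleftrightarrow>
     (\<exists>E :: (point \<times> point) set. finite E \<and> frontier \<Omega> = (\<Union>(a, b) \<in> E. closed_segment a b))"

definition polygonal_lipschitz_domain :: "point set \<Rightarrow> bool" where
  "polygonal_lipschitz_domain \<Omega> \<longleftrightarrow>
     open \<Omega> \<and> connected \<Omega> \<and> bounded \<Omega> \<and> polygonal_boundary \<Omega> \<and> lipschitz_boundary \<Omega>"

text \<open>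
  Conformity (two triangles meet in a common, possibly empty, face) is part of the library
  notion \<^const>\<open>triangulation\<close>.
\<close>

definition conforming_triangulation :: "point set set \<Rightarrow> point set \<Rightarrow> bool" where
  "conforming_triangulation T \<Omega> \<longleftrightarrow>
     triangulation T \<and> (\<forall>\<tau> \<in> T. 2 simplex \<tau>) \<and> \<Union>T = closure \<Omega>"

definition vertices :: "point set \<Rightarrow> point set" where
  "vertices \<tau> = {\<xi>. \<xi> extreme_point_of \<tau>}"

definition interior_vertex :: "point set set \<Rightarrow> point set \<Rightarrow> point \<Rightarrow> bool" where
  "interior_vertex T \<Omega> z \<longleftrightarrow> z \<in> \<Omega> \<and> (\<exists>\<tau> \<in> T. z \<in> vertices \<tau>)"


section \<open>Dual mesh\<close>

definition barycenter :: "point set \<Rightarrow> point" where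
  "barycenter \<tau> = (1/3) *\<^sub>R (\<Sum>\<xi> \<in> vertices \<tau>. \<xi>)"

text \<open>
  The quadrilateral \<open>t\<^sub>\<xi>\<close>; the vertex \<open>\<xi>\<close> itself arises as the degenerate midpoint
  \<open>midpoint \<xi> \<xi>\<close>.
\<close>

definition dual_quad :: "point set \<Rightarrow> point \<Rightarrow> point set" where
  "dual_quad \<tau> \<xi> = convex hull (insert (barycenter \<tau>) (midpoint \<xi> ` vertices \<tau>))"

definition control_volume :: "point set set \<Rightarrow> point \<Rightarrow> point set" where
  "control_volume T \<xi> = (\<Union>\<tau> \<in> {\<tau> \<in> T. \<xi> \<in> vertices \<tau>}. dual_quad \<tau> \<xi>)"

text \<open>
  Integral over \<open>\<partial>C\<^sup>\<xi> \<inter> \<partial>t\<^sub>\<xi>\<close>, which by definition consists of the two segments from the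
  barycenter to the midpoints of the edges at \<open>\<xi>\<close>.
\<close>

definition dual_boundary_integral :: "point set \<Rightarrow> point \<Rightarrow> (point \<Rightarrow> real) \<Rightarrow> real" where
  "dual_boundary_integral \<tau> \<xi> h =
     (\<Sum>\<eta> \<in> vertices \<tau> - {\<xi>}. segment_integral (barycenter \<tau>) (midpoint \<xi> \<eta>) h)"

definition dual_boundary_integrable :: "point set \<Rightarrow> point \<Rightarrow> (point \<Rightarrow> real) \<Rightarrow> bool" where
  "dual_boundary_integrable \<tau> \<xi> h \<longleftrightarrow>
     (\<forall>\<eta> \<in> vertices \<tau> - {\<xi>}. segment_integrable (barycenter \<tau>) (midpoint \<xi> \<eta>) h)"


section \<open>Finite element spaces\<close>

definition linear_on_elem :: "point set \<Rightarrow> (point \<Rightarrow> real) \<Rightarrow> bool" where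
  "linear_on_elem \<tau> w \<longleftrightarrow> (\<exists>a b. \<forall>x \<in> \<tau>. w x = a \<bullet> x + b)"

definition piecewise_linear :: "point set set \<Rightarrow> point set \<Rightarrow> (point \<Rightarrow> real) \<Rightarrow> bool" where
  "piecewise_linear T \<Omega> w \<longleftrightarrow>
     continuous_on (closure \<Omega>) w \<and> (\<forall>\<tau> \<in> T. linear_on_elem \<tau> w)"

definition V\<^sub>h :: "point set set \<Rightarrow> point set \<Rightarrow> (point \<Rightarrow> real) set" where
  "V\<^sub>h T \<Omega> = {w. piecewise_linear T \<Omega> w \<and> (\<forall>x \<in> frontier \<Omega>. w x = 0)}"

definition interpolant ::
  "point set set \<Rightarrow> point set \<Rightarrow> (point \<Rightarrow> real) \<Rightarrow> (point \<Rightarrow> real) \<Rightarrow> bool" where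
  "interpolant T \<Omega> g g\<^sub>h \<longleftrightarrow>
     piecewise_linear T \<Omega> g\<^sub>h \<and> (\<forall>\<tau> \<in> T. \<forall>\<xi> \<in> vertices \<tau>. g\<^sub>h \<xi> = g \<xi>)"

text \<open>
  Nodal basis functions of an element, extended from \<open>\<tau>\<close> to the whole plane as affine functions.
\<close>

definition nodal :: "point set \<Rightarrow> point \<Rightarrow> point \<Rightarrow> real" where
  "nodal \<tau> \<xi> = (THE \<phi>. linear_on_elem UNIV \<phi> \<and>
                       (\<forall>\<eta> \<in> vertices \<tau>. \<phi> \<eta> = (if \<eta> = \<xi> then 1 else 0)))"

definition V_elem :: "point set \<Rightarrow> (point \<Rightarrow> real) set" where
  "V_elem \<tau> = {w. \<exists>c :: point \<Rightarrow> real. w = (\<lambda>x. \<Sum>\<xi> \<in> vertices \<tau>. c \<xi> * nodal \<tau> \<xi> x)}"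


section \<open>The SUPG/CGFEM discretization\<close>

text \<open>
  For piecewise linear \<open>u\<close> the derivatives below are evaluated at points of the interior of
  \<open>\<tau>\<close> only, up to a null set; hence they are elementwise derivatives.
\<close>

definition galerkin_integrand ::
  "(point \<Rightarrow> real) \<Rightarrow> (point \<Rightarrow> point) \<Rightarrow> (point \<Rightarrow> real) \<Rightarrow> (point \<Rightarrow> real) \<Rightarrow> point \<Rightarrow> real" where
  "galerkin_integrand k v u w x = (k x *\<^sub>R grad u x - u x *\<^sub>R v x) \<bullet> grad w x"

definition supg_integrand ::
  "real \<Rightarrow> (point \<Rightarrow> real) \<Rightarrow> (point \<Rightarrow> point) \<Rightarrow> (point \<Rightarrow> real) \<Rightarrow> (point \<Rightarrow> real) \<Rightarrow> point \<Rightarrow> real"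
  where
  "supg_integrand \<delta> k v u w x =
     \<delta> * divergence (\<lambda>y. - (k y *\<^sub>R grad u y) + u y *\<^sub>R v y) x * (v x \<bullet> grad w x)"

definition load_integrand ::
  "real \<Rightarrow> (point \<Rightarrow> point) \<Rightarrow> (point \<Rightarrow> real) \<Rightarrow> (point \<Rightarrow> real) \<Rightarrow> point \<Rightarrow> real" where
  "load_integrand \<delta> v f w x = f x * (w x + \<delta> * (v x \<bullet> grad w x))"

definition a_elem ::
  "real \<Rightarrow> (point \<Rightarrow> real) \<Rightarrow> (point \<Rightarrow> point) \<Rightarrow> point set \<Rightarrow>
   (point \<Rightarrow> real) \<Rightarrow> (point \<Rightarrow> real) \<Rightarrow> real" where
  "a_elem \<delta> k v \<tau> u w =
     (LINT x:\<tau>|lebesgue. galerkin_integrand k v u w x) +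
     (LINT x:\<tau>|lebesgue. supg_integrand \<delta> k v u w x)"

definition l_elem ::
  "real \<Rightarrow> (point \<Rightarrow> point) \<Rightarrow> (point \<Rightarrow> real) \<Rightarrow> point set \<Rightarrow> (point \<Rightarrow> real) \<Rightarrow> real" where
  "l_elem \<delta> v f \<tau> w = (LINT x:\<tau>|lebesgue. load_integrand \<delta> v f w x)"

definition supg_solution ::
  "real \<Rightarrow> (point \<Rightarrow> real) \<Rightarrow> (point \<Rightarrow> point) \<Rightarrow> (point \<Rightarrow> real) \<Rightarrow>
   point set set \<Rightarrow> point set \<Rightarrow> (point \<Rightarrow> real) \<Rightarrow> (point \<Rightarrow> real) \<Rightarrow> bool" where
  "supg_solution \<delta> k v f T \<Omega> g\<^sub>h u\<^sub>h \<longleftrightarrow>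
     (\<lambda>x. u\<^sub>h x - g\<^sub>h x) \<in> V\<^sub>h T \<Omega> \<and>
     (\<forall>w \<in> V\<^sub>h T \<Omega>. (\<Sum>\<tau> \<in> T. a_elem \<delta> k v \<tau> u\<^sub>h w) = (\<Sum>\<tau> \<in> T. l_elem \<delta> v f \<tau> w))"


section \<open>Assumptions on the data\<close>

definition coefficient_assumptions ::
  "point set \<Rightarrow> (point \<Rightarrow> real) \<Rightarrow> (point \<Rightarrow> point) \<Rightarrow> bool" where
  "coefficient_assumptions \<Omega> k v \<longleftrightarrow>
     (\<exists>k\<^sub>m\<^sub>i\<^sub>n k\<^sub>m\<^sub>a\<^sub>x. 0 < k\<^sub>m\<^sub>i\<^sub>n \<and> (\<forall>x \<in> \<Omega>. k\<^sub>m\<^sub>i\<^sub>n \<le> k x \<and> k x \<le> k\<^sub>m\<^sub>a\<^sub>x)) \<and>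
     (\<forall>x \<in> \<Omega>. v differentiable at x \<and> divergence v x \<ge> 0)"

text \<open>
  All integrands that occur make sense and are integrable. Differentiability of \<open>k\<close> is needed
  only for the stabilization term, and only inside the elements.
\<close>

definition integrals_exist ::
  "real \<Rightarrow> (point \<Rightarrow> real) \<Rightarrow> (point \<Rightarrow> point) \<Rightarrow> (point \<Rightarrow> real) \<Rightarrow> point set set \<Rightarrow> bool" where
  "integrals_exist \<delta> k v f T \<longleftrightarrow>
     (\<forall>\<tau> \<in> T.
        (\<delta> \<noteq> 0 \<longrightarrow> (\<forall>x \<in> interior \<tau>. k differentiable at x)) \<and>
        set_integrable lebesgue \<tau> f \<and>
        (\<forall>p \<in> V_elem \<tau>. \<forall>q \<in> V_elem \<tau>.
           set_integrable lebesgue \<tau> (galerkin_integrand k v p q) \<and>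
           set_integrable lebesgue \<tau> (supg_integrand \<delta> k v p q) \<and>
           set_integrable lebesgue \<tau> (load_integrand \<delta> v f q)) \<and>
        (\<forall>\<xi> \<in> vertices \<tau>. \<forall>p \<in> V_elem \<tau>.
           dual_boundary_integrable \<tau> \<xi>
             (\<lambda>x. (k x *\<^sub>R grad p x) \<bullet> outward_normal (dual_quad \<tau> \<xi>) x) \<and>
           dual_boundary_integrable \<tau> \<xi>
             (\<lambda>x. (p x *\<^sub>R v x) \<bullet> outward_normal (dual_quad \<tau> \<xi>) x)))"


section \<open>The elemental Neumann problem\<close>

text \<open>
  The balance on each \<open>t\<^sub>\<xi>\<close> after the prescribed flux \<open>F\<^sup>\<xi> - Q\<^sup>\<xi>\<close> through
  \<open>\<partial>\<tau> \<inter> \<partial>t\<^sub>\<xi>\<close> has been substituted.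
\<close>

definition neumann_solution ::
  "real \<Rightarrow> (point \<Rightarrow> real) \<Rightarrow> (point \<Rightarrow> point) \<Rightarrow> (point \<Rightarrow> real) \<Rightarrow>
   (point \<Rightarrow> real) \<Rightarrow> point set \<Rightarrow> (point \<Rightarrow> real) \<Rightarrow> bool" where
  "neumann_solution \<delta> k v f u\<^sub>h \<tau> u\<^sub>\<tau> \<longleftrightarrow>
     u\<^sub>\<tau> \<in> V_elem \<tau> \<and>
     (\<forall>\<xi> \<in> vertices \<tau>.
        - dual_boundary_integral \<tau> \<xi>
            (\<lambda>x. (k x *\<^sub>R grad u\<^sub>\<tau> x) \<bullet> outward_normal (dual_quad \<tau> \<xi>) x) =
        a_elem \<delta> k v \<tau> u\<^sub>h (nodal \<tau> \<xi>) - l_elem \<delta> v f \<tau> (nodal \<tau> \<xi>)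
        + (LINT x:dual_quad \<tau> \<xi>|lebesgue. f x)
        - dual_boundary_integral \<tau> \<xi>
            (\<lambda>x. (u\<^sub>h x *\<^sub>R v x) \<bullet> outward_normal (dual_quad \<tau> \<xi>) x))"

end

theory Submission
  imports Defs
begin

text \<open>
  Summing the Neumann balances at \<open>z\<close> over the triangles having \<open>z\<close> as a vertex, the terms
  \<open>Q\<^sup>z - F\<^sup>z\<close> add up to \<open>a(u\<^sub>h, w) - \<ell>(w)\<close> for the hat function \<open>w\<close> at \<open>z\<close>, which vanishes because
  \<open>w \<in> V\<^sub>h\<close>. What remains is geometry: the dual segments in these triangles make up the boundary of the
  control volume, and near their points its normal is that of the quadrilateral.

  To control the geometry, extend the barycentric coordinates of each triangle at \<open>z\<close> to the cone with
  apex \<open>z\<close> that it spans. As \<open>z\<close> is interior, the cones cover the plane; as the mesh is conforming,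
  the coordinates agree on overlaps, hence glue to continuous functions on the plane. The control volume
  is the set where the coordinate of \<open>z\<close> is the largest, and \<open>w\<close> is the positive part of that
  coordinate. The open set \<open>{w > 0}\<close> lies in the closure of \<open>\<Omega>\<close>, hence in \<open>\<Omega>\<close>, since a Lipschitz
  domain is the interior of its closure.
\<close>

section \<open>Locality of derivatives and integrals\<close>

text \<open>\<open>grad\<close> is a definite description, so it is enough that both functions admit
  the same candidates \<open>D\<close>; points of non-differentiability are thereby covered as
  well.\<close>

lemma grad_cong_open:
  assumes "open S" "x \<in> S" "\<And>y. y \<in> S \<Longrightarrow> u y = w y"
  shows "grad u x = grad w x"
proof -
  have "GDERIV u x :> D \<longleftrightarrow> GDERIV w x :> D" for D
    unfolding gderiv_def
    using has_derivative_transform_within_open[OF _ assms(1,2), of u _ UNIV w]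
      has_derivative_transform_within_open[OF _ assms(1,2), of w _ UNIV u] assms(3)
    by (auto simp: eq_commute)
  then show ?thesis
    by (simp add: grad_def)
qed

lemma grad_zero: "grad (\<lambda>x. 0) x = 0"
proof -
  have "GDERIV (\<lambda>x. 0) x :> (0 :: point)"
    by (simp add: gderiv_def)
  moreover have "D = 0" if "GDERIV (\<lambda>x. 0) x :> D" for D :: point
  proof -
    have "(\<lambda>h. inner h D) = (\<lambda>h. 0)"
      using that unfolding gderiv_def by (rule has_derivative_unique) simp
    then show ?thesis
      by (metis inner_eq_zero_iff)
  qed
  ultimately show ?thesis
    unfolding grad_def by (rule the_equality)
qed

lemma set_integral_spike:
  fixes f g :: "'a::euclidean_space \<Rightarrow> 'b::euclidean_space"
  assumes "negligible N" "\<And>x. x \<in> S - N \<Longrightarrow> g x = f x"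
  shows "(LINT x:S|lebesgue. f x) = (LINT x:S|lebesgue. g x)"
proof (cases "f absolutely_integrable_on S")
  case True
  then have "g absolutely_integrable_on S"
    by (rule absolutely_integrable_spike[OF _ assms])
  with True show ?thesis
    using integral_spike[OF assms] by (simp add: set_lebesgue_integral_eq_integral)
next
  \<comment> \<open>Integrability fails for both functions or for neither; here both integrals take
    the default value 0.\<close>
  case False
  moreover have "\<not> g absolutely_integrable_on S"
    using False absolutely_integrable_spike_eq[OF assms(1), of S g f] assms(2) by simp
  ultimately show ?thesis
    by (simp add: set_lebesgue_integral_def set_integrable_def not_integrable_integral_eq)
qed

text \<open>A convex set has negligible frontier. This matters because the values of a function on
  an element fix its gradient only in the interior of that element.\<close>

lemma set_integral_cong_interior:
  fixes f g :: "'a::euclidean_space \<Rightarrow> 'b::euclidean_space"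
  assumes "convex S" "\<And>x. x \<in> interior S \<Longrightarrow> g x = f x"
  shows "(LINT x:S|lebesgue. f x) = (LINT x:S|lebesgue. g x)"
proof (rule set_integral_spike)
  show "negligible (frontier S)"
    using assms(1) by (rule negligible_convex_frontier)
  show "g x = f x" if "x \<in> S - frontier S" for x
    using that assms(2) closure_subset by (auto simp: frontier_def)
qed

lemma a_elem_cong:
  assumes "convex \<tau>" "\<And>x. x \<in> \<tau> \<Longrightarrow> w x = w' x"
  shows "a_elem \<delta> k v \<tau> u w = a_elem \<delta> k v \<tau> u w'"
proof -
  have "grad w x = grad w' x" if "x \<in> interior \<tau>" for x
    using that assms(2) interior_subset by (intro grad_cong_open[of "interior \<tau>"]) auto
  then show ?thesis
    unfolding a_elem_def
    by (intro arg_cong2[where f = "(+)"] set_integral_cong_interior assms(1))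
      (simp_all add: galerkin_integrand_def supg_integrand_def)
qed

lemma l_elem_cong:
  assumes "convex \<tau>" "\<And>x. x \<in> \<tau> \<Longrightarrow> w x = w' x"
  shows "l_elem \<delta> v f \<tau> w = l_elem \<delta> v f \<tau> w'"
proof -
  have "grad w x = grad w' x" "w x = w' x" if "x \<in> interior \<tau>" for x
    using that assms(2) interior_subset by (auto intro!: grad_cong_open[of "interior \<tau>"])
  then show ?thesis
    unfolding l_elem_def
    by (intro set_integral_cong_interior assms(1)) (simp add: load_integrand_def)
qed

lemma a_elem_zero [simp]: "a_elem \<delta> k v \<tau> u (\<lambda>x. 0) = 0"
  by (simp add: a_elem_def galerkin_integrand_def supg_integrand_def grad_zero)

lemma l_elem_zero [simp]: "l_elem \<delta> v f \<tau> (\<lambda>x. 0) = 0"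
  by (simp add: l_elem_def load_integrand_def grad_zero)

text \<open>The condition that defines the normal only asks for some radius, so the ball can be
  shrunk until it lies in \<open>U\<close>, where the two sets coincide.\<close>

lemma outward_normal_cong:
  assumes "open U" "x \<in> U" "C \<inter> U = D \<inter> U"
  shows "outward_normal C x = outward_normal D x"
proof -
  have *: "\<exists>\<epsilon>>0. B \<inter> ball x \<epsilon> = {y \<in> ball x \<epsilon>. (y - x) \<bullet> n \<le> 0}"
    if eq: "A \<inter> U = B \<inter> U" and A: "\<exists>\<epsilon>>0. A \<inter> ball x \<epsilon> = {y \<in> ball x \<epsilon>. (y - x) \<bullet> n \<le> 0}"
    for A B n
  proof -
    obtain \<epsilon> where \<epsilon>: "\<epsilon> > 0" "A \<inter> ball x \<epsilon> = {y \<in> ball x \<epsilon>. (y - x) \<bullet> n \<le> 0}"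
      using A by auto
    obtain \<rho> where \<rho>: "\<rho> > 0" "ball x \<rho> \<subseteq> U"
      using assms open_contains_ball by blast
    have "B \<inter> ball x (min \<epsilon> \<rho>) = A \<inter> ball x \<epsilon> \<inter> ball x \<rho>"
      using eq \<rho>(2) by (auto simp: subset_iff)
    also have "\<dots> = {y \<in> ball x (min \<epsilon> \<rho>). (y - x) \<bullet> n \<le> 0}"
      unfolding \<epsilon>(2) by auto
    finally show ?thesis
      using \<epsilon>(1) \<rho>(1) by (intro exI[of _ "min \<epsilon> \<rho>"]) auto
  qed
  have "(\<exists>\<epsilon>>0. C \<inter> ball x \<epsilon> = {y \<in> ball x \<epsilon>. (y - x) \<bullet> n \<le> 0}) \<longleftrightarrow>
        (\<exists>\<epsilon>>0. D \<inter> ball x \<epsilon> = {y \<in> ball x \<epsilon>. (y - x) \<bullet> n \<le> 0})" for n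
    using *[OF assms(3)] *[OF assms(3)[symmetric]] by (rule iffI)
  then show ?thesis
    by (simp add: outward_normal_def)
qed

section \<open>Integrals over segments\<close>

lemma segment_point_mem:
  assumes "a \<noteq> b" "t \<in> {0..1} - {1}"
  shows "a + t *\<^sub>R (b - a) \<in> closed_segment a b - {b}"
proof -
  have "a + t *\<^sub>R (b - a) - b = (1 - t) *\<^sub>R (a - b)"
    by (simp add: algebra_simps)
  then have "a + t *\<^sub>R (b - a) \<noteq> b"
    using assms by auto
  moreover have "a + t *\<^sub>R (b - a) \<in> closed_segment a b"
    using assms(2) unfolding in_segment by (intro exI[of _ t]) (auto simp: algebra_simps)
  ultimately show ?thesis
    by simp
qed

text \<open>The endpoint \<open>b\<close>, a single parameter value, is left out because it will be
  an edge midpoint: it lies on the boundary of the element, where the flux is not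
  prescribed.\<close>

lemma segment_integrable_spike:
  assumes "segment_integrable a b f" "\<And>x. x \<in> closed_segment a b - {b} \<Longrightarrow> g x = f x" "a \<noteq> b"
  shows "segment_integrable a b g"
  unfolding segment_integrable_def
proof (rule absolutely_integrable_spike[OF assms(1)[unfolded segment_integrable_def], of "{1}"])
  show "g (a + t *\<^sub>R (b - a)) = f (a + t *\<^sub>R (b - a))" if "t \<in> {0..1} - {1}" for t
    using assms(2) segment_point_mem[OF assms(3) that] .
qed auto

lemma segment_integral_spike:
  assumes "\<And>x. x \<in> closed_segment a b - {b} \<Longrightarrow> g x = f x" "a \<noteq> b"
  shows "segment_integral a b f = segment_integral a b g"
  unfolding segment_integral_def
  using assms(1)[OF segment_point_mem[OF assms(2)]]
  by (intro arg_cong2[where f = "(*)"] set_integral_spike[of "{1}"]) auto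

lemma segment_integral_add:
  assumes "segment_integrable a b f" "segment_integrable a b g"
  shows "segment_integrable a b (\<lambda>x. f x + g x)"
    "segment_integral a b (\<lambda>x. f x + g x) = segment_integral a b f + segment_integral a b g"
  using assms unfolding segment_integrable_def segment_integral_def
  by (auto simp: set_integral_add algebra_simps)

lemma segment_integral_minus:
  assumes "segment_integrable a b f"
  shows "segment_integrable a b (\<lambda>x. - f x)"
    "segment_integral a b (\<lambda>x. - f x) = - segment_integral a b f"
  using assms unfolding segment_integrable_def segment_integral_def
  by (auto simp: set_integral_uminus set_integrable_def)

text \<open>A point of the interior of the closure outside \<Omega> would be a boundary point, with
  the domain locally above a graph. Points straight below it have a neighbourhood strictly below the
  graph, hence are not in the closure, although they come arbitrarily close.\<close>

lemma interior_closure_lipschitz_subset: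
  assumes "lipschitz_boundary \<Omega>"
  shows "interior (closure \<Omega>) \<subseteq> \<Omega>"
proof
  fix p assume p: "p \<in> interior (closure \<Omega>)"
  show "p \<in> \<Omega>"
  proof (rule ccontr)
    assume np: "p \<notin> \<Omega>"
    then have "p \<notin> interior \<Omega>"
      using interior_subset by blast
    then have "p \<in> frontier \<Omega>"
      using p interior_subset unfolding frontier_def by blast
    then obtain d e r L and \<gamma> :: "real \<Rightarrow> real" where
      de: "norm e = 1" "d \<bullet> e = 0" and r: "r > 0" and lip: "L-lipschitz_on UNIV \<gamma>"
      and eq: "\<Omega> \<inter> ball p r = {y \<in> ball p r. \<gamma> ((y - p) \<bullet> d) < (y - p) \<bullet> e}"
      using assms unfolding lipschitz_boundary_def by blast
    have "p \<notin> {y \<in> ball p r. \<gamma> ((y - p) \<bullet> d) < (y - p) \<bullet> e}"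
      using eq np by blast
    then have \<gamma>0: "\<gamma> 0 \<ge> 0"
      using r by simp
    obtain \<rho> where \<rho>: "\<rho> > 0" "ball p \<rho> \<subseteq> closure \<Omega>"
      using p mem_interior by blast
    \<comment> \<open>Small enough for \<open>q\<close> to stay in the ball inside the closure and
      in the ball of the graph representation.\<close>
    define t where "t = min \<rho> r / 2"
    have t: "t > 0" "t < \<rho>" "t < r"
      using \<rho>(1) r by (auto simp: t_def)
    define q where "q = p - t *\<^sub>R e"
    define U where "U = {y. \<gamma> ((y - p) \<bullet> d) > (y - p) \<bullet> e} \<inter> ball p r"
    have cont: "continuous_on UNIV \<gamma>"
      using lip by (rule lipschitz_on_continuous_on)
    have "open U"
      unfolding U_def
      by (intro open_Int open_Collect_less open_ball continuous_intros
          continuous_on_compose2[OF cont]) auto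
    moreover have "q \<in> U"
      using \<gamma>0 t de by (simp add: U_def q_def dist_norm inner_commute[of e d] power2_norm_eq_inner[symmetric])
    moreover have "U \<inter> \<Omega> = {}"
      using eq unfolding U_def by force
    ultimately have "q \<notin> closure \<Omega>"
      by (metis disjoint_iff open_Int_closure_eq_empty)
    moreover have "q \<in> ball p \<rho>"
      using t de by (simp add: q_def dist_norm)
    ultimately show False
      using \<rho>(2) by blast
  qed
qed

section \<open>Barycentric coordinates on a triangle\<close>

lemma triangle_vertices:
  fixes \<tau> :: "point set"
  assumes "2 simplex \<tau>"
  shows "finite (vertices \<tau>)" "card (vertices \<tau>) = 3" "\<not> affine_dependent (vertices \<tau>)"
    "\<tau> = convex hull (vertices \<tau>)" "affine hull (vertices \<tau>) = UNIV"
proof -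
  obtain C where C: "\<not> affine_dependent C" "int (card C) = 2 + 1" "\<tau> = convex hull C"
    using assms unfolding simplex_def by blast
  have eq: "vertices \<tau> = C"
    unfolding vertices_def C(3) by (simp add: extreme_point_of_convex_hull_affine_independent C(1))
  show "finite (vertices \<tau>)" "card (vertices \<tau>) = 3" "\<not> affine_dependent (vertices \<tau>)"
    "\<tau> = convex hull (vertices \<tau>)"
    using C eq by (auto intro: aff_independent_finite)
  have "aff_dim C = 2"
    using C by (simp add: aff_dim_affine_independent)
  then show "affine hull (vertices \<tau>) = UNIV"
    using aff_dim_eq_full[of C] by (simp add: eq)
qed

text \<open>Translating by a point of \<open>C\<close> turns affine into linear independence, so the
  values extend to a linear functional; \<open>adjoint\<close> represents it as an inner
  product.\<close>

lemma affine_function_extension: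
  fixes C :: "'a::euclidean_space set"
  assumes "\<not> affine_dependent C"
  obtains a b where "\<And>x. x \<in> C \<Longrightarrow> a \<bullet> x + b = h x"
proof (cases "C = {}")
  case True
  then show thesis
    using that by simp
next
  case False
  then obtain c where c: "c \<in> C"
    by blast
  have "independent ((\<lambda>x. - c + x) ` (C - {c}))"
    using assms affine_dependent_iff_dependent2[OF c] by blast
  then obtain f :: "'a \<Rightarrow> real" where f: "linear f"
    "\<forall>y \<in> (\<lambda>x. - c + x) ` (C - {c}). f y = h (c + y) - h c"
    using linear_independent_extend[of _ "\<lambda>y. h (c + y) - h c"] by blast
  have "adjoint f 1 \<bullet> x = f x" for x
    using adjoint_works[OF f(1), of x 1] by (simp add: inner_commute)
  moreover have "f x - f c = h x - h c" if "x \<in> C" for x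
    using f that by (cases "x = c") (auto simp: linear_diff)
  ultimately show thesis
    by (intro that[of "adjoint f 1" "h c - f c"]) (simp add: algebra_simps)
qed

text \<open>Two affine functions agree on an affine set. Here it contains the vertices, whose affine
  hull is the plane.\<close>

lemma linear_on_elem_UNIV_eqI:
  assumes "2 simplex \<tau>" "linear_on_elem UNIV \<phi>" "linear_on_elem UNIV \<psi>"
    and "\<And>\<eta>. \<eta> \<in> vertices \<tau> \<Longrightarrow> \<phi> \<eta> = \<psi> \<eta>"
  shows "\<phi> = \<psi>"
proof -
  obtain a b c d where \<phi>: "\<phi> = (\<lambda>x. a \<bullet> x + b)" and \<psi>: "\<psi> = (\<lambda>x. c \<bullet> x + d)"
    using assms(2,3) unfolding linear_on_elem_def by (auto simp: fun_eq_iff)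
  have "affine hull (vertices \<tau>) \<subseteq> {x. (a - c) \<bullet> x = d - b}"
    using assms(4) by (intro hull_minimal affine_hyperplane) (auto simp: \<phi> \<psi> algebra_simps)
  then show ?thesis
    unfolding triangle_vertices(5)[OF assms(1)] by (auto simp: \<phi> \<psi> fun_eq_iff algebra_simps subset_iff)
qed

text \<open>For \<open>\<xi>\<close> that is not a vertex of \<open>\<tau>\<close>, \<open>nodal \<tau> \<xi>\<close> is the zero function.\<close>

lemma nodal_props:
  assumes "2 simplex \<tau>"
  shows "linear_on_elem UNIV (nodal \<tau> \<xi>)"
    "\<eta> \<in> vertices \<tau> \<Longrightarrow> nodal \<tau> \<xi> \<eta> = (if \<eta> = \<xi> then 1 else 0)"
proof -
  obtain a b where ab: "\<And>x. x \<in> vertices \<tau> \<Longrightarrow> a \<bullet> x + b = (if x = \<xi> then 1 else 0)"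
    using affine_function_extension[OF triangle_vertices(3)[OF assms], of "\<lambda>x. if x = \<xi> then 1 else 0"]
    by blast
  have lin: "linear_on_elem UNIV (\<lambda>x. a \<bullet> x + b)"
    unfolding linear_on_elem_def by blast
  have "\<exists>!\<phi>. linear_on_elem UNIV \<phi> \<and> (\<forall>\<eta> \<in> vertices \<tau>. \<phi> \<eta> = (if \<eta> = \<xi> then 1 else 0))"
  proof (rule ex1I[of _ "\<lambda>x. a \<bullet> x + b"])
    show "linear_on_elem UNIV (\<lambda>x. a \<bullet> x + b) \<and>
        (\<forall>\<eta> \<in> vertices \<tau>. a \<bullet> \<eta> + b = (if \<eta> = \<xi> then 1 else 0))"
      using ab lin by simp
    show "\<phi> = (\<lambda>x. a \<bullet> x + b)"
      if "linear_on_elem UNIV \<phi> \<and> (\<forall>\<eta> \<in> vertices \<tau>. \<phi> \<eta> = (if \<eta> = \<xi> then 1 else 0))" for \<phi>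
      using that ab lin by (intro linear_on_elem_UNIV_eqI[OF assms]) simp_all
  qed
  from theI'[OF this] show "linear_on_elem UNIV (nodal \<tau> \<xi>)"
    "\<eta> \<in> vertices \<tau> \<Longrightarrow> nodal \<tau> \<xi> \<eta> = (if \<eta> = \<xi> then 1 else 0)"
    by (simp_all add: nodal_def)
qed

lemma nodal_affine:
  assumes "2 simplex \<tau>"
  obtains a b where "nodal \<tau> \<xi> = (\<lambda>x. a \<bullet> x + b)"
  using nodal_props(1)[OF assms, of \<xi>] unfolding linear_on_elem_def by (auto simp: fun_eq_iff)

lemma nodal_continuous_on:
  assumes "2 simplex \<tau>"
  shows "continuous_on S (nodal \<tau> \<xi>)"
proof -
  obtain a b where ab: "nodal \<tau> \<xi> = (\<lambda>x. a \<bullet> x + b)"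
    using nodal_affine[OF assms] .
  show ?thesis
    unfolding ab by (intro continuous_intros)
qed

text \<open>The parameter \<open>s\<close> is unrestricted, since points beyond the segment from
  \<open>x\<close> to \<open>y\<close> are needed too.\<close>

lemma nodal_convex_comb:
  assumes "2 simplex \<tau>"
  shows "nodal \<tau> \<xi> (x + s *\<^sub>R (y - x)) = (1 - s) * nodal \<tau> \<xi> x + s * nodal \<tau> \<xi> y"
proof -
  obtain a b where ab: "nodal \<tau> \<xi> = (\<lambda>x. a \<bullet> x + b)"
    using nodal_affine[OF assms] .
  show ?thesis
    by (simp add: ab inner_add_right inner_diff_right algebra_simps)
qed

lemma nodal_sum_scaleR:
  assumes "2 simplex \<tau>" "finite V" "sum u V = 1"
  shows "nodal \<tau> \<xi> (\<Sum>\<eta>\<in>V. u \<eta> *\<^sub>R \<eta>) = (\<Sum>\<eta>\<in>V. u \<eta> * nodal \<tau> \<xi> \<eta>)"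
proof -
  obtain a b where ab: "nodal \<tau> \<xi> = (\<lambda>x. a \<bullet> x + b)"
    using nodal_affine[OF assms(1)] .
  show ?thesis
    using assms(3)
    by (simp add: ab inner_sum_right ring_distribs sum.distrib flip: sum_distrib_right)
qed

text \<open>Affine functions respect affine combinations; this identifies the nodal functions with
  the barycentric coordinates.\<close>

lemma nodal_vertices_sum:
  assumes "2 simplex \<tau>" "sum u (vertices \<tau>) = 1"
  shows "nodal \<tau> \<xi> (\<Sum>\<eta>\<in>vertices \<tau>. u \<eta> *\<^sub>R \<eta>) = (if \<xi> \<in> vertices \<tau> then u \<xi> else 0)"
proof -
  have "(\<Sum>\<eta>\<in>vertices \<tau>. u \<eta> * nodal \<tau> \<xi> \<eta>) = (\<Sum>\<eta>\<in>vertices \<tau>. if \<eta> = \<xi> then u \<eta> else 0)"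
    by (intro sum.cong) (auto simp: nodal_props(2)[OF assms(1)])
  then show ?thesis
    using nodal_sum_scaleR[OF assms(1) triangle_vertices(1)[OF assms(1)] assms(2), of \<xi>]
      triangle_vertices(1)[OF assms(1)] by (simp add: sum.delta)
qed

lemma nodal_expansion:
  assumes "2 simplex \<tau>"
  shows "(\<Sum>\<eta>\<in>vertices \<tau>. nodal \<tau> \<eta> x) = 1" "(\<Sum>\<eta>\<in>vertices \<tau>. nodal \<tau> \<eta> x *\<^sub>R \<eta>) = x"
proof -
  have "x \<in> affine hull (vertices \<tau>)"
    by (simp add: triangle_vertices(5)[OF assms])
  then obtain u where u: "sum u (vertices \<tau>) = 1" "(\<Sum>\<eta>\<in>vertices \<tau>. u \<eta> *\<^sub>R \<eta>) = x"
    using affine_hull_finite[OF triangle_vertices(1)[OF assms]] by auto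
  have "nodal \<tau> \<eta> x = u \<eta>" if "\<eta> \<in> vertices \<tau>" for \<eta>
    using nodal_vertices_sum[OF assms u(1), of \<eta>] u(2) that by simp
  then show "(\<Sum>\<eta>\<in>vertices \<tau>. nodal \<tau> \<eta> x) = 1"
    "(\<Sum>\<eta>\<in>vertices \<tau>. nodal \<tau> \<eta> x *\<^sub>R \<eta>) = x"
    using u by simp_all
qed

lemma nodal_not_vertex:
  assumes "2 simplex \<tau>" "\<xi> \<notin> vertices \<tau>"
  shows "nodal \<tau> \<xi> x = 0"
  using nodal_vertices_sum[OF assms(1) nodal_expansion(1)[OF assms(1)], of \<xi> x]
    nodal_expansion(2)[OF assms(1), of x] assms(2) by simp

text \<open>The quantifier may range over all points because the nodal function of a non-vertex
  vanishes.\<close>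

lemma mem_triangle_iff:
  assumes "2 simplex \<tau>"
  shows "x \<in> \<tau> \<longleftrightarrow> (\<forall>\<eta>. 0 \<le> nodal \<tau> \<eta> x)"
proof
  assume "x \<in> \<tau>"
  then have "x \<in> convex hull (vertices \<tau>)"
    using triangle_vertices(4)[OF assms] by simp
  then obtain u where u: "\<forall>\<eta>\<in>vertices \<tau>. 0 \<le> u \<eta>" "sum u (vertices \<tau>) = 1"
    "(\<Sum>\<eta>\<in>vertices \<tau>. u \<eta> *\<^sub>R \<eta>) = x"
    using convex_hull_finite[OF triangle_vertices(1)[OF assms]] by auto
  then show "\<forall>\<eta>. 0 \<le> nodal \<tau> \<eta> x"
    using nodal_vertices_sum[OF assms u(2)] by auto
next
  assume "\<forall>\<eta>. 0 \<le> nodal \<tau> \<eta> x"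
  then have "x \<in> convex hull (vertices \<tau>)"
    unfolding convex_hull_finite[OF triangle_vertices(1)[OF assms]]
    using nodal_expansion[OF assms, of x] by (intro CollectI exI[of _ "\<lambda>\<eta>. nodal \<tau> \<eta> x"]) auto
  then show "x \<in> \<tau>"
    using triangle_vertices(4)[OF assms] by simp
qed

lemma mem_interior_triangle:
  assumes "2 simplex \<tau>" "\<And>\<eta>. \<eta> \<in> vertices \<tau> \<Longrightarrow> 0 < nodal \<tau> \<eta> x"
  shows "x \<in> interior \<tau>"
proof -
  define U where "U = (\<Inter>\<eta>\<in>vertices \<tau>. {y. 0 < nodal \<tau> \<eta> y})"
  have "open U"
    unfolding U_def using triangle_vertices(1)[OF assms(1)]
    by (intro open_INT ballI open_Collect_less nodal_continuous_on assms(1)) auto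
  moreover have "U \<subseteq> \<tau>"
  proof
    fix y assume "y \<in> U"
    then have "0 \<le> nodal \<tau> \<eta> y" for \<eta>
      using nodal_not_vertex[OF assms(1), of \<eta>] by (cases "\<eta> \<in> vertices \<tau>") (auto simp: U_def less_imp_le)
    then show "y \<in> \<tau>"
      by (simp add: mem_triangle_iff[OF assms(1)])
  qed
  moreover have "x \<in> U"
    using assms(2) by (simp add: U_def)
  ultimately show ?thesis
    using interior_maximal by blast
qed

lemma triangle_vertices_at:
  assumes "2 simplex \<tau>" "z \<in> vertices \<tau>" "\<eta> \<in> vertices \<tau>" "\<eta> \<noteq> z"
  obtains \<zeta> where "vertices \<tau> = {z, \<eta>, \<zeta>}" "\<zeta> \<noteq> z" "\<zeta> \<noteq> \<eta>"
proof -
  have "card (vertices \<tau> - {z} - {\<eta>}) = 1"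
    using assms triangle_vertices(1,2)[OF assms(1)] by simp
  then obtain \<zeta> where "vertices \<tau> - {z} - {\<eta>} = {\<zeta>}"
    by (auto simp: card_1_singleton_iff)
  then have "vertices \<tau> = {z, \<eta>, \<zeta>}" "\<zeta> \<noteq> z" "\<zeta> \<noteq> \<eta>"
    using assms by blast+
  then show thesis
    using that by blast
qed

lemma triangle_other_vertex:
  assumes "2 simplex \<tau>" "z \<in> vertices \<tau>"
  obtains \<eta> where "\<eta> \<in> vertices \<tau>" "\<eta> \<noteq> z"
proof -
  have "card (vertices \<tau> - {z}) = 2"
    using triangle_vertices(1,2)[OF assms(1)] assms(2) by simp
  then obtain \<eta> where "\<eta> \<in> vertices \<tau> - {z}"
    by (metis card.empty ex_in_conv zero_neq_numeral)
  then show thesis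
    using that by blast
qed

lemma linear_on_elem_V_elem:
  assumes "2 simplex \<tau>" "linear_on_elem \<tau> u"
  obtains p where "p \<in> V_elem \<tau>" "\<And>x. x \<in> \<tau> \<Longrightarrow> p x = u x"
proof -
  obtain a b where ab: "\<And>x. x \<in> \<tau> \<Longrightarrow> u x = a \<bullet> x + b"
    using assms(2) unfolding linear_on_elem_def by blast
  define p where "p = (\<lambda>x. \<Sum>\<xi>\<in>vertices \<tau>. (a \<bullet> \<xi> + b) * nodal \<tau> \<xi> x)"
  have "p x = a \<bullet> x + b" for x
  proof -
    have "a \<bullet> x + b = a \<bullet> (\<Sum>\<xi>\<in>vertices \<tau>. nodal \<tau> \<xi> x *\<^sub>R \<xi>) + b * (\<Sum>\<xi>\<in>vertices \<tau>. nodal \<tau> \<xi> x)"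
      by (simp add: nodal_expansion[OF assms(1)])
    also have "\<dots> = p x"
      by (simp add: p_def inner_sum_right sum_distrib_left sum.distrib algebra_simps)
    finally show ?thesis ..
  qed
  moreover have "p \<in> V_elem \<tau>"
    by (auto simp: V_elem_def p_def)
  ultimately show thesis
    using that ab by simp
qed

lemma nodal_midpoint:
  assumes "2 simplex \<tau>"
  shows "nodal \<tau> \<xi> (midpoint x y) = (nodal \<tau> \<xi> x + nodal \<tau> \<xi> y) / 2"
proof -
  obtain a b where ab: "nodal \<tau> \<xi> = (\<lambda>x. a \<bullet> x + b)"
    using nodal_affine[OF assms] .
  show ?thesis
    by (simp add: ab midpoint_def inner_add_right field_simps)
qed

lemma nodal_barycenter:
  assumes "2 simplex \<tau>"
  shows "nodal \<tau> \<xi> (barycenter \<tau>) = (if \<xi> \<in> vertices \<tau> then 1/3 else 0)"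
  using nodal_vertices_sum[OF assms, of "\<lambda>_. 1/3" \<xi>] triangle_vertices(2)[OF assms]
  by (simp add: barycenter_def scaleR_sum_right)

lemma triangle_eqI:
  assumes "2 simplex \<tau>" "\<And>\<xi>. \<xi> \<in> vertices \<tau> \<Longrightarrow> nodal \<tau> \<xi> x = nodal \<tau> \<xi> y"
  shows "x = y"
proof -
  have "x = (\<Sum>\<xi>\<in>vertices \<tau>. nodal \<tau> \<xi> x *\<^sub>R \<xi>)"
    by (simp add: nodal_expansion(2)[OF assms(1)])
  also have "\<dots> = (\<Sum>\<xi>\<in>vertices \<tau>. nodal \<tau> \<xi> y *\<^sub>R \<xi>)"
    using assms(2) by simp
  also have "\<dots> = y"
    by (simp add: nodal_expansion(2)[OF assms(1)])
  finally show ?thesis .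
qed

lemma nodal_translate:
  assumes "2 simplex \<tau>"
  shows "nodal \<tau> \<xi> (x + s *\<^sub>R (y - w)) = nodal \<tau> \<xi> x + s * (nodal \<tau> \<xi> y - nodal \<tau> \<xi> w)"
proof -
  obtain a b where ab: "nodal \<tau> \<xi> = (\<lambda>x. a \<bullet> x + b)"
    using nodal_affine[OF assms] .
  show ?thesis
    by (simp add: ab inner_add_right inner_diff_right algebra_simps)
qed

text \<open>As the coordinate of \<xi> at \<open>x\<close> is positive, \<open>x\<close> can be
  pushed away from \<xi> without leaving the triangle. Then \<open>x\<close> lies strictly between
  \<xi> and another point of the triangle, and a face containing \<open>x\<close> contains both
  ends.\<close>

lemma vertex_mem_face:
  assumes "2 simplex \<tau>" "F face_of \<tau>" "x \<in> F" "0 < nodal \<tau> \<xi> x"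
  shows "\<xi> \<in> F"
proof (cases "x = \<xi>")
  case False
  define c where "c = nodal \<tau> \<xi> x"
  \<comment> \<open>This changes the coordinate of \<xi> from \<open>c\<close> to
    \<open>c * c\<close> and multiplies the others by \<open>1 + c\<close>, so none becomes
    negative.\<close>
  define y where "y = x + (- c) *\<^sub>R (\<xi> - x)"
  have c: "c > 0"
    using assms(4) by (simp add: c_def)
  have x: "x \<in> \<tau>"
    using assms(2,3) face_of_imp_subset by blast
  have \<xi>: "\<xi> \<in> vertices \<tau>"
    using assms(4) nodal_not_vertex[OF assms(1), of \<xi> x] by force
  have "0 \<le> nodal \<tau> \<eta> y" for \<eta>
  proof -
    have "0 \<le> nodal \<tau> \<eta> x"
      using x mem_triangle_iff[OF assms(1)] by blast
    then show ?thesis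
      using c nodal_props(2)[OF assms(1) \<xi>, of \<eta>]
      unfolding y_def nodal_convex_comb[OF assms(1)]
      by (cases "\<eta> = \<xi>") (auto simp: c_def algebra_simps)
  qed
  then have "y \<in> \<tau>"
    by (simp add: mem_triangle_iff[OF assms(1)])
  moreover have "\<xi> \<in> \<tau>"
    using \<xi> by (simp add: vertices_def extreme_point_of_def)
  moreover have "x \<in> open_segment y \<xi>"
  proof -
    have "y \<noteq> \<xi>"
    proof
      assume "y = \<xi>"
      then have "(1 + c) *\<^sub>R (x - \<xi>) = 0"
        by (simp add: y_def algebra_simps)
      then show False
        using c False by simp
    qed
    moreover have "(1 + c) *\<^sub>R x = (1 + c) *\<^sub>R ((1 - c / (1 + c)) *\<^sub>R y + (c / (1 + c)) *\<^sub>R \<xi>)"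
    proof -
      have "(1 + c) * (1 - c / (1 + c)) = 1"
        using c by (simp add: field_simps)
      then have "(1 + c) *\<^sub>R ((1 - c / (1 + c)) *\<^sub>R y + (c / (1 + c)) *\<^sub>R \<xi>) = y + c *\<^sub>R \<xi>"
        using c by (simp add: scaleR_add_right)
      then show ?thesis
        by (simp add: y_def algebra_simps)
    qed
    then have "x = (1 - c / (1 + c)) *\<^sub>R y + (c / (1 + c)) *\<^sub>R \<xi>"
      using c by (metis add_pos_pos less_numeral_extra(1,3) scaleR_left_imp_eq)
    ultimately show ?thesis
      using c unfolding in_segment by (intro conjI exI[of _ "c / (1 + c)"]) (auto simp: field_simps)
  qed
  ultimately show ?thesis
    using face_ofD[OF assms(2)] assms(3) by blast
qed (use assms in simp)

section \<open>Dual quadrilaterals\<close>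

text \<open>The parameter \<open>s\<close> is 0 at the edge midpoint and 1 at the barycenter, so
  that the coordinate of the third vertex is positive away from the midpoint.\<close>

lemma nodal_segment:
  assumes "2 simplex \<tau>" "z \<in> vertices \<tau>" "\<eta> \<in> vertices \<tau>" "\<eta> \<noteq> z"
    and "x \<in> closed_segment (barycenter \<tau>) (midpoint z \<eta>)"
  obtains s where "0 \<le> s" "s \<le> 1" "s = 0 \<Longrightarrow> x = midpoint z \<eta>"
    "\<And>\<xi>. \<xi> \<in> vertices \<tau> \<Longrightarrow> nodal \<tau> \<xi> x = (if \<xi> = z \<or> \<xi> = \<eta> then 1/2 - s/6 else s/3)"
proof -
  obtain t where t: "0 \<le> t" "t \<le> 1" "x = barycenter \<tau> + t *\<^sub>R (midpoint z \<eta> - barycenter \<tau>)"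
    using assms(5) unfolding in_segment by (auto simp: algebra_simps)
  show thesis
  proof (rule that[of "1 - t"])
    show "nodal \<tau> \<xi> x = (if \<xi> = z \<or> \<xi> = \<eta> then 1/2 - (1 - t)/6 else (1 - t)/3)"
      if "\<xi> \<in> vertices \<tau>" for \<xi>
      using that assms(2-4) unfolding t(3) nodal_convex_comb[OF assms(1)]
      by (auto simp: nodal_midpoint nodal_barycenter nodal_props(2) assms(1) field_simps)
  qed (use t in auto)
qed

text \<open>The segment is the part of a median, where the coordinates of \<open>z\<close> and
  \<eta> tie, on which this common value is the largest and the third coordinate is not
  negative.\<close>

lemma mem_dual_segment_iff:
  assumes "2 simplex \<tau>" "z \<in> vertices \<tau>" "\<eta> \<in> vertices \<tau>" "\<eta> \<noteq> z"
  shows "x \<in> closed_segment (barycenter \<tau>) (midpoint z \<eta>) \<longleftrightarrow>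
    nodal \<tau> z x = nodal \<tau> \<eta> x \<and> (\<forall>\<xi>. 0 \<le> nodal \<tau> \<xi> x \<and> nodal \<tau> \<xi> x \<le> nodal \<tau> z x)"
    (is "?l \<longleftrightarrow> ?r")
proof
  assume ?l
  then obtain s where s: "0 \<le> s" "s \<le> 1"
    "\<And>\<xi>. \<xi> \<in> vertices \<tau> \<Longrightarrow> nodal \<tau> \<xi> x = (if \<xi> = z \<or> \<xi> = \<eta> then 1/2 - s/6 else s/3)"
    using nodal_segment[OF assms] by metis
  have "0 \<le> nodal \<tau> \<xi> x \<and> nodal \<tau> \<xi> x \<le> nodal \<tau> z x" for \<xi>
    using s assms(2) nodal_not_vertex[OF assms(1), of \<xi> x] by (cases "\<xi> \<in> vertices \<tau>") auto
  then show ?r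
    using s(3) assms(2,3) by simp
next
  assume r: ?r
  obtain \<zeta> where \<zeta>: "vertices \<tau> = {z, \<eta>, \<zeta>}" "\<zeta> \<noteq> z" "\<zeta> \<noteq> \<eta>"
    using triangle_vertices_at[OF assms] .
  define c where "c = nodal \<tau> \<zeta> x"
  have sum: "2 * nodal \<tau> z x + c = 1"
    using nodal_expansion(1)[OF assms(1), of x] r \<zeta> assms(4) by (simp add: c_def)
  have c: "0 \<le> c" "3 * c \<le> 1"
    using r sum by (auto simp: c_def dest: spec[of _ \<zeta>])
  \<comment> \<open>The third coordinate falls linearly from 1/3 at the barycenter to 0 at the
    midpoint; its value \<open>c\<close> therefore determines the parameter.\<close>
  have "x = barycenter \<tau> + (1 - 3 * c) *\<^sub>R (midpoint z \<eta> - barycenter \<tau>)"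
  proof (rule triangle_eqI[OF assms(1)])
    fix \<xi> assume "\<xi> \<in> vertices \<tau>"
    then show "nodal \<tau> \<xi> x = nodal \<tau> \<xi> (barycenter \<tau> + (1 - 3 * c) *\<^sub>R (midpoint z \<eta> - barycenter \<tau>))"
      using r sum \<zeta> assms(4) unfolding nodal_convex_comb[OF assms(1)]
      by (auto simp: nodal_midpoint nodal_barycenter nodal_props(2) assms(1) c_def field_simps)
  qed
  then show ?l
    using c unfolding in_segment by (intro exI[of _ "1 - 3 * c"]) (auto simp: algebra_simps)
qed

lemma dual_segment_interior:
  assumes "2 simplex \<tau>" "z \<in> vertices \<tau>" "\<eta> \<in> vertices \<tau>" "\<eta> \<noteq> z"
    and "x \<in> closed_segment (barycenter \<tau>) (midpoint z \<eta>)" "x \<noteq> midpoint z \<eta>"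
  shows "x \<in> interior \<tau>"
proof -
  obtain s where s: "0 \<le> s" "s \<le> 1" "s = 0 \<Longrightarrow> x = midpoint z \<eta>"
    "\<And>\<xi>. \<xi> \<in> vertices \<tau> \<Longrightarrow> nodal \<tau> \<xi> x = (if \<xi> = z \<or> \<xi> = \<eta> then 1/2 - s/6 else s/3)"
    using nodal_segment[OF assms(1-5)] by metis
  then have "s > 0"
    using assms(6) by force
  then show ?thesis
    using s by (intro mem_interior_triangle assms(1)) auto
qed

lemma dual_segment_nondegenerate:
  assumes "2 simplex \<tau>" "z \<in> vertices \<tau>" "\<eta> \<in> vertices \<tau>" "\<eta> \<noteq> z"
  shows "barycenter \<tau> \<noteq> midpoint z \<eta>"
proof
  assume eq: "barycenter \<tau> = midpoint z \<eta>"
  show False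
    using arg_cong[OF eq, of "nodal \<tau> z"] assms
    by (simp add: nodal_midpoint nodal_barycenter nodal_props(2))
qed

text \<open>The right-hand side is a convex condition satisfied by the corners. Conversely, once the
  coordinates of the two other vertices are ordered, \<open>x\<close> lies in one of the two
  triangles into which the diagonal from \<open>z\<close> to the barycenter cuts the
  quadrilateral.\<close>

lemma mem_dual_quad_iff:
  assumes "2 simplex \<tau>" "z \<in> vertices \<tau>"
  shows "x \<in> dual_quad \<tau> z \<longleftrightarrow> (\<forall>\<xi>. 0 \<le> nodal \<tau> \<xi> x \<and> nodal \<tau> \<xi> x \<le> nodal \<tau> z x)"
    (is "_ \<longleftrightarrow> ?r x")
proof
  obtain \<eta> where "\<eta> \<in> vertices \<tau>" "\<eta> \<noteq> z"
    using triangle_other_vertex[OF assms] .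
  then obtain \<zeta> where V: "vertices \<tau> = {z, \<eta>, \<zeta>}" "\<eta> \<noteq> z" "\<zeta> \<noteq> z" "\<zeta> \<noteq> \<eta>"
    using triangle_vertices_at[OF assms, of \<eta>] by auto
  {
    assume x: "x \<in> dual_quad \<tau> z"
    have "convex {x. ?r x}"
    proof (rule convexI)
      fix x y and u v :: real
      assume h: "x \<in> {x. ?r x}" "y \<in> {x. ?r x}" "0 \<le> u" "0 \<le> v" "u + v = 1"
      have eq: "u *\<^sub>R x + v *\<^sub>R y = x + v *\<^sub>R (y - x)"
        using h(5) by (simp add: algebra_simps flip: scaleR_add_left)
      have u: "1 - v = u"
        using h(5) by simp
      have "nodal \<tau> \<xi> (u *\<^sub>R x + v *\<^sub>R y) = u * nodal \<tau> \<xi> x + v * nodal \<tau> \<xi> y" for \<xi>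
        unfolding eq nodal_convex_comb[OF assms(1)] u ..
      then show "u *\<^sub>R x + v *\<^sub>R y \<in> {x. ?r x}"
        using h(1-4) by (auto intro!: add_mono mult_left_mono)
    qed
    moreover have "?r (midpoint z \<xi>)" if "\<xi> \<in> vertices \<tau>" for \<xi>
      using that assms by (auto simp: nodal_midpoint nodal_props(2))
    moreover have "?r (barycenter \<tau>)"
      using assms by (auto simp: nodal_barycenter)
    ultimately have "dual_quad \<tau> z \<subseteq> {x. ?r x}"
      unfolding dual_quad_def by (intro hull_minimal) auto
    then show "?r x"
      using x by blast
  }
  {
    assume r: "?r x"
    have *: "x \<in> dual_quad \<tau> z"
      if V: "vertices \<tau> = {z, \<eta>, \<zeta>}" "\<eta> \<noteq> z" "\<zeta> \<noteq> z" "\<zeta> \<noteq> \<eta>"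
        and le: "nodal \<tau> \<zeta> x \<le> nodal \<tau> \<eta> x" for \<eta> \<zeta>
    proof -
      define a b c where "a = nodal \<tau> z x" "b = nodal \<tau> \<eta> x" "c = nodal \<tau> \<zeta> x"
      note abc = this
      have sum: "a + b + c = 1"
        using nodal_expansion(1)[OF assms(1), of x] V by (simp add: abc)
      have "x = a *\<^sub>R z + b *\<^sub>R \<eta> + c *\<^sub>R \<zeta>"
        using nodal_expansion(2)[OF assms(1), of x] V by (simp add: abc add.assoc)
      \<comment> \<open>The barycenter accounts for the smallest coordinate of all three vertices,
        the midpoint for the excess \<open>b - c\<close> of \<open>z\<close> and \<eta>, and
        \<open>z\<close> for the rest.\<close>
      also have "\<dots> = (3 * c) *\<^sub>R barycenter \<tau> + (2 * (b - c)) *\<^sub>R midpoint z \<eta> + (a - b) *\<^sub>R midpoint z z"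
        using V by (simp add: barycenter_def midpoint_def algebra_simps)
      finally have "x \<in> convex hull {barycenter \<tau>, midpoint z \<eta>, midpoint z z}"
        unfolding convex_hull_3 using sum r le
        by (intro CollectI exI[of _ "3 * c"] exI[of _ "2 * (b - c)"] exI[of _ "a - b"])
          (auto simp: abc)
      also have "\<dots> \<subseteq> dual_quad \<tau> z"
        unfolding dual_quad_def by (intro hull_mono) (simp add: V(1))
      finally show ?thesis .
    qed
    have V': "vertices \<tau> = {z, \<zeta>, \<eta>}"
      using V(1) by blast
    show "x \<in> dual_quad \<tau> z"
      using *[OF V] *[OF V' V(3,2) V(4)[symmetric]] by linarith
  }
qed

lemma dual_quad_subset:
  assumes "2 simplex \<tau>" "z \<in> vertices \<tau>"
  shows "dual_quad \<tau> z \<subseteq> \<tau>"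
  using mem_dual_quad_iff[OF assms] mem_triangle_iff[OF assms(1)] by blast

lemma dual_quad_compact:
  assumes "2 simplex \<tau>"
  shows "compact (dual_quad \<tau> z)"
  unfolding dual_quad_def using triangle_vertices(1)[OF assms]
  by (intro compact_convex_hull finite_imp_compact) auto

section \<open>The star of an interior vertex\<close>

locale vertex_star =
  fixes T :: "point set set" and z :: point
  assumes triangulation: "triangulation T"
    and triangle: "\<tau> \<in> T \<Longrightarrow> 2 simplex \<tau>"
    and interior: "z \<in> interior (\<Union>T)"
    and vertex: "\<exists>\<tau> \<in> T. z \<in> vertices \<tau>"
begin

section \<open>Elements at \<open>z\<close>, their cones and the glued coordinates\<close>

definition star :: "point set set" where
  "star = {\<tau> \<in> T. z \<in> vertices \<tau>}"

text \<open>Leaving the coordinate of \<open>z\<close> free removes the side opposite to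
  \<open>z\<close>, so the triangle becomes a full cone.\<close>

definition corner_cone :: "point set \<Rightarrow> point set" where
  "corner_cone \<tau> = {y. \<forall>\<eta>. \<eta> \<noteq> z \<longrightarrow> 0 \<le> nodal \<tau> \<eta> y}"

text \<open>A suitable triangle exists by \<open>cone_cover\<close>, and its choice is immaterial by
  \<open>cone_agree\<close>.\<close>

definition coord :: "point \<Rightarrow> point \<Rightarrow> real" where
  "coord \<xi> y = nodal (SOME \<tau>. \<tau> \<in> star \<and> y \<in> corner_cone \<tau>) \<xi> y"

lemma starD: "\<tau> \<in> star \<Longrightarrow> \<tau> \<in> T" "\<tau> \<in> star \<Longrightarrow> z \<in> vertices \<tau>" "\<tau> \<in> star \<Longrightarrow> 2 simplex \<tau>"
  using triangle by (auto simp: star_def)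

lemma finite_T: "finite T"
  using triangulation by (simp add: triangulation_def)

lemma finite_star: "finite star"
  using finite_T by (simp add: star_def)

lemma face_of_Int_T:
  assumes "\<tau> \<in> T" "\<tau>' \<in> T"
  shows "\<tau> \<inter> \<tau>' face_of \<tau>"
  using triangulation assms by (simp add: triangulation_def)

text \<open>A vertex is a one-point face, hence a face of the intersection; by conformity the
  intersection is a face of \<open>\<tau>'\<close>, and faces of faces are faces.\<close>

lemma vertex_common:
  assumes "\<tau> \<in> T" "\<tau>' \<in> T" "\<xi> \<in> vertices \<tau>" "\<xi> \<in> \<tau>'"
  shows "\<xi> \<in> vertices \<tau>'"
proof -
  have \<xi>: "{\<xi>} face_of \<tau>"
    using assms(3) by (simp add: vertices_def face_of_singleton)
  then have "{\<xi>} \<subseteq> \<tau> \<inter> \<tau>'"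
    using assms(4) face_of_imp_subset by blast
  then have "{\<xi>} face_of (\<tau>' \<inter> \<tau>)"
    using face_of_subset[OF \<xi>, of "\<tau>' \<inter> \<tau>"] by blast
  then have "{\<xi>} face_of \<tau>'"
    using face_of_Int_T[OF assms(2,1)] face_of_trans by blast
  then show ?thesis
    by (simp add: vertices_def face_of_singleton)
qed

text \<open>By \<open>vertex_mem_face\<close> only common vertices carry a nonzero coordinate of
  \<open>p\<close> in \<tau>. The expansion of \<open>p\<close> over the vertices of \<tau> is thus
  one over those of \<open>\<tau>'\<close>, where coordinates are unique.\<close>

lemma nodal_agree:
  assumes "\<tau> \<in> T" "\<tau>' \<in> T" "p \<in> \<tau>" "p \<in> \<tau>'"
  shows "nodal \<tau> \<zeta> p = nodal \<tau>' \<zeta> p"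
proof -
  note s = triangle[OF assms(1)] triangle[OF assms(2)]
  let ?V = "vertices \<tau>" and ?V' = "vertices \<tau>'"
  have zero: "nodal \<tau> \<xi> p = 0" if "\<xi> \<notin> ?V \<inter> ?V'" for \<xi>
  proof (rule ccontr)
    assume "nodal \<tau> \<xi> p \<noteq> 0"
    moreover have "0 \<le> nodal \<tau> \<xi> p"
      using assms(3) mem_triangle_iff[OF s(1)] by blast
    ultimately have "\<xi> \<in> \<tau> \<inter> \<tau>'" "\<xi> \<in> ?V"
      using vertex_mem_face[OF s(1) face_of_Int_T[OF assms(1,2)], of p \<xi>] assms(3,4)
        nodal_not_vertex[OF s(1), of \<xi> p] by force+
    then show False
      using that vertex_common[OF assms(1,2)] by blast
  qed
  have fin: "finite (?V \<union> ?V')"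
    using s triangle_vertices(1) by blast
  have "(\<Sum>\<xi>\<in>?V'. nodal \<tau> \<xi> p) = (\<Sum>\<xi>\<in>?V \<union> ?V'. nodal \<tau> \<xi> p)"
    using fin zero by (intro sum.mono_neutral_left) auto
  also have "\<dots> = (\<Sum>\<xi>\<in>?V. nodal \<tau> \<xi> p)"
    using fin zero by (intro sum.mono_neutral_right) auto
  finally have 1: "(\<Sum>\<xi>\<in>?V'. nodal \<tau> \<xi> p) = 1"
    by (simp add: nodal_expansion(1)[OF s(1)])
  have "(\<Sum>\<xi>\<in>?V'. nodal \<tau> \<xi> p *\<^sub>R \<xi>) = (\<Sum>\<xi>\<in>?V \<union> ?V'. nodal \<tau> \<xi> p *\<^sub>R \<xi>)"
    using fin zero by (intro sum.mono_neutral_left) auto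
  also have "\<dots> = (\<Sum>\<xi>\<in>?V. nodal \<tau> \<xi> p *\<^sub>R \<xi>)"
    using fin zero by (intro sum.mono_neutral_right) auto
  finally have "(\<Sum>\<xi>\<in>?V'. nodal \<tau> \<xi> p *\<^sub>R \<xi>) = p"
    by (simp add: nodal_expansion(2)[OF s(1)])
  then show ?thesis
    using nodal_vertices_sum[OF s(2) 1, of \<zeta>] zero[of \<zeta>] by (cases "\<zeta> \<in> ?V'") auto
qed

text \<open>Dilations about \<open>z\<close> carry statements about the triangles near
  \<open>z\<close> over to the cones.\<close>

lemma nodal_scaled:
  assumes "\<tau> \<in> star"
  shows "nodal \<tau> \<eta> (z + s *\<^sub>R (y - z)) = (if \<eta> = z then 1 - s else 0) + s * nodal \<tau> \<eta> y"
  unfolding nodal_convex_comb[OF starD(3)[OF assms]]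
  by (simp add: nodal_props(2)[OF starD(3,2)[OF assms]])

lemma cone_agree:
  assumes "\<tau> \<in> star" "\<tau>' \<in> star" "y \<in> corner_cone \<tau>" "y \<in> corner_cone \<tau>'"
  shows "nodal \<tau> \<zeta> y = nodal \<tau>' \<zeta> y"
proof -
  \<comment> \<open>Large enough that shrinking towards \<open>z\<close> by the factor
    \<open>1 / a\<close> makes the coordinate of \<open>z\<close> non-negative in both triangles, so
    the shrunk point lies in both and \<open>nodal_agree\<close> applies.\<close>
  define a where "a = 1 + \<bar>nodal \<tau> z y\<bar> + \<bar>nodal \<tau>' z y\<bar>"
  define s where "s = 1 / a"
  have a: "a > 0"
    by (simp add: a_def add_pos_nonneg)
  then have s: "s > 0" "s * a = 1"
    by (auto simp: s_def)
  have mem: "z + s *\<^sub>R (y - z) \<in> \<sigma>"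
    if \<sigma>: "\<sigma> \<in> star" "y \<in> corner_cone \<sigma>" and le: "1 - nodal \<sigma> z y \<le> a" for \<sigma>
  proof -
    have "s * (1 - nodal \<sigma> z y) \<le> 1"
      using mult_left_mono[OF le, of s] s by simp
    then have "0 \<le> nodal \<sigma> \<eta> (z + s *\<^sub>R (y - z))" for \<eta>
      using \<sigma>(2) s unfolding nodal_scaled[OF \<sigma>(1)] by (auto simp: corner_cone_def algebra_simps)
    then show ?thesis
      by (simp add: mem_triangle_iff[OF starD(3)[OF \<sigma>(1)]])
  qed
  have "z + s *\<^sub>R (y - z) \<in> \<tau>" "z + s *\<^sub>R (y - z) \<in> \<tau>'"
    by (rule mem; use assms in \<open>auto simp: a_def\<close>)+
  from nodal_agree[OF starD(1)[OF assms(1)] starD(1)[OF assms(2)] this, of \<zeta>] show ?thesis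
    using s unfolding nodal_scaled[OF assms(1)] nodal_scaled[OF assms(2)] by simp
qed

lemma small_translate:
  fixes d x :: point
  assumes "open U" "x \<in> U"
  obtains s where "s > 0" "x + s *\<^sub>R d \<in> U"
proof -
  obtain \<epsilon> where \<epsilon>: "\<epsilon> > 0" "ball x \<epsilon> \<subseteq> U"
    using assms open_contains_ball by blast
  define s where "s = \<epsilon> / (1 + norm d)"
  have "norm (s *\<^sub>R d) < \<epsilon>"
    using \<epsilon>(1) by (simp add: s_def divide_less_eq add_pos_nonneg)
  then show thesis
    using \<epsilon> by (intro that[of s]) (auto simp: s_def add_pos_nonneg dist_norm subset_iff)
qed

text \<open>Close to the interior point \<open>z\<close> only elements of the star occur, so
  \<open>y\<close> shrunk far enough towards \<open>z\<close> lies in one of them; dilating back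
  stays in its cone.\<close>

lemma cone_cover: "\<exists>\<tau>\<in>star. y \<in> corner_cone \<tau>"
proof -
  obtain \<tau>0 where \<tau>0: "\<tau>0 \<in> T" "z \<in> vertices \<tau>0"
    using vertex by blast
  define U where "U = interior (\<Union>T) - \<Union>(T - star)"
  have "closed (\<Union>(T - star))"
    using finite_T triangle closed_simplex by (intro closed_Union) auto
  then have "open U"
    unfolding U_def by (intro open_Diff) auto
  \<comment> \<open>By conformity an element containing \<open>z\<close> has it as a vertex, so
    \<open>z\<close> avoids the closed union of the other elements.\<close>
  moreover have "z \<in> U"
    using interior vertex_common[OF \<tau>0(1) _ \<tau>0(2)] by (auto simp: U_def star_def)
  ultimately obtain s where s: "s > 0" "z + s *\<^sub>R (y - z) \<in> U"
    using small_translate by blast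
  then have "z + s *\<^sub>R (y - z) \<in> \<Union>T" "z + s *\<^sub>R (y - z) \<notin> \<Union>(T - star)"
    using interior_subset by (auto simp only: U_def)
  then obtain \<tau> where \<tau>: "\<tau> \<in> star" "z + s *\<^sub>R (y - z) \<in> \<tau>"
    by blast
  have "0 \<le> nodal \<tau> \<eta> y" if "\<eta> \<noteq> z" for \<eta>
  proof -
    have "0 \<le> nodal \<tau> \<eta> (z + s *\<^sub>R (y - z))"
      using \<tau>(2) mem_triangle_iff[OF starD(3)[OF \<tau>(1)]] by blast
    then show ?thesis
      using that s(1) unfolding nodal_scaled[OF \<tau>(1)] by (simp add: zero_le_mult_iff)
  qed
  then show ?thesis
    using \<tau>(1) by (auto simp: corner_cone_def)
qed

lemma coord_eq:
  assumes "\<tau> \<in> star" "y \<in> corner_cone \<tau>"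
  shows "coord \<xi> y = nodal \<tau> \<xi> y"
proof -
  have "(SOME \<tau>. \<tau> \<in> star \<and> y \<in> corner_cone \<tau>) \<in> star \<and> y \<in> corner_cone (SOME \<tau>. \<tau> \<in> star \<and> y \<in> corner_cone \<tau>)"
    by (rule someI[of _ \<tau>]) (use assms in simp)
  then show ?thesis
    unfolding coord_def using assms by (intro cone_agree) auto
qed

lemma subset_cone: "\<tau> \<in> star \<Longrightarrow> \<tau> \<subseteq> corner_cone \<tau>"
  using mem_triangle_iff[OF starD(3)] by (auto simp: corner_cone_def)

text \<open>Affine pieces that agree on overlaps are pasted along finitely many closed
  cones.\<close>

lemma coord_continuous: "continuous_on UNIV (coord \<xi>)"
proof -
  have "continuous_on (\<Union>\<tau>\<in>star. corner_cone \<tau>) (coord \<xi>)"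
  proof (rule continuous_on_closed_Union)
    fix \<tau> assume \<tau>: "\<tau> \<in> star"
    show "closed (corner_cone \<tau>)"
      unfolding corner_cone_def
      by (intro closed_Collect_all closed_Collect_imp open_Collect_const closed_Collect_le
          nodal_continuous_on starD(3) \<tau> continuous_intros)
    show "continuous_on (corner_cone \<tau>) (coord \<xi>)"
      using nodal_continuous_on[OF starD(3)[OF \<tau>], of _ \<xi>] by (rule continuous_on_eq) (simp add: coord_eq[OF \<tau>])
  qed (rule finite_star)
  moreover have "(\<Union>\<tau>\<in>star. corner_cone \<tau>) = UNIV"
    using cone_cover by blast
  ultimately show ?thesis
    by simp
qed

section \<open>The control volume and its boundary\<close>

definition star_vertices :: "point set" where
  "star_vertices = (\<Union>\<tau>\<in>star. vertices \<tau>)"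

lemma finite_star_vertices: "finite star_vertices"
  unfolding star_vertices_def using finite_star starD(3) triangle_vertices(1) by blast

lemma control_volume_star: "control_volume T z = (\<Union>\<tau>\<in>star. dual_quad \<tau> z)"
  by (simp add: control_volume_def star_def)

text \<open>This describes the control volume by finitely many inequalities between continuous
  functions on the plane, from which its interior and frontier can be read off.\<close>

lemma mem_control_volume_iff:
  "y \<in> control_volume T z \<longleftrightarrow> (\<forall>\<xi> \<in> star_vertices - {z}. coord \<xi> y \<le> coord z y)"
proof
  assume "y \<in> control_volume T z"
  then obtain \<tau> where \<tau>: "\<tau> \<in> star" "y \<in> dual_quad \<tau> z"
    unfolding control_volume_star by blast
  then have "y \<in> corner_cone \<tau>"
    using dual_quad_subset[OF starD(3,2)] subset_cone by blast
  then show "\<forall>\<xi> \<in> star_vertices - {z}. coord \<xi> y \<le> coord z y"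
    using \<tau>(2) unfolding mem_dual_quad_iff[OF starD(3,2)[OF \<tau>(1)]]
    by (simp add: coord_eq[OF \<tau>(1)])
next
  assume r: "\<forall>\<xi> \<in> star_vertices - {z}. coord \<xi> y \<le> coord z y"
  obtain \<tau> where \<tau>: "\<tau> \<in> star" "y \<in> corner_cone \<tau>"
    using cone_cover by blast
  have le: "nodal \<tau> \<xi> y \<le> nodal \<tau> z y" if "\<xi> \<in> vertices \<tau>" for \<xi>
    using r that \<tau> by (cases "\<xi> = z") (auto simp: star_vertices_def coord_eq[OF \<tau>])
  \<comment> \<open>The coordinate of \<eta> is non-negative on the cone, and that of
    \<open>z\<close> dominates it; hence \<open>y\<close> lies in the triangle itself.\<close>
  obtain \<eta> where "\<eta> \<in> vertices \<tau>" "\<eta> \<noteq> z"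
    using triangle_other_vertex[OF starD(3,2)[OF \<tau>(1)]] .
  then have "0 \<le> nodal \<tau> z y"
    using le \<tau>(2) by (fastforce simp: corner_cone_def)
  then have "0 \<le> nodal \<tau> \<xi> y \<and> nodal \<tau> \<xi> y \<le> nodal \<tau> z y" for \<xi>
    using le \<tau>(2) nodal_not_vertex[OF starD(3)[OF \<tau>(1)], of \<xi> y]
    by (cases "\<xi> = z"; cases "\<xi> \<in> vertices \<tau>") (auto simp: corner_cone_def)
  then have "y \<in> dual_quad \<tau> z"
    by (simp add: mem_dual_quad_iff[OF starD(3,2)[OF \<tau>(1)]])
  then show "y \<in> control_volume T z"
    using \<tau>(1) unfolding control_volume_star by blast
qed

lemma closed_control_volume: "closed (control_volume T z)"
  unfolding control_volume_star
  using finite_star dual_quad_compact[OF starD(3)] by (intro closed_UN) (auto intro: compact_imp_closed)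

text \<open>Where all inequalities are strict the point is interior, so a frontier point has a tie
  between \<open>z\<close> and another vertex. At a tie with \<eta>, any small shift in the
  direction \<open>\<eta> - z\<close> leaves the control volume.\<close>

lemma frontier_control_volume:
  "frontier (control_volume T z) =
    (\<Union>\<tau>\<in>star. \<Union>\<eta>\<in>vertices \<tau> - {z}. closed_segment (barycenter \<tau>) (midpoint z \<eta>))"
    (is "frontier ?C = ?S")
proof
  show "frontier ?C \<subseteq> ?S"
  proof
    fix x assume "x \<in> frontier ?C"
    then have x: "x \<in> ?C" "x \<notin> interior ?C"
      using closed_control_volume by (auto simp: frontier_def)
    define U where "U = (\<Inter>\<xi>\<in>star_vertices - {z}. {y. coord \<xi> y < coord z y})"
    have "open U"
      unfolding U_def using finite_star_vertices
      by (intro open_INT ballI open_Collect_less coord_continuous) auto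
    moreover have "U \<subseteq> ?C"
      by (auto simp: U_def mem_control_volume_iff less_imp_le)
    ultimately have "x \<notin> U"
      using x(2) interior_maximal by blast
    then obtain \<xi> where \<xi>: "\<xi> \<noteq> z" "coord z x \<le> coord \<xi> x"
      by (auto simp: U_def not_less)
    obtain \<tau> where \<tau>: "\<tau> \<in> star" "x \<in> dual_quad \<tau> z"
      using x(1) unfolding control_volume_star by blast
    note s = starD(3,2)[OF \<tau>(1)]
    have "x \<in> corner_cone \<tau>"
      using \<tau> dual_quad_subset[OF s] subset_cone by blast
    then have ge: "nodal \<tau> z x \<le> nodal \<tau> \<xi> x"
      using \<xi>(2) by (simp add: coord_eq[OF \<tau>(1)])
    have le: "0 \<le> nodal \<tau> \<eta> x \<and> nodal \<tau> \<eta> x \<le> nodal \<tau> z x" for \<eta>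
      using \<tau>(2) unfolding mem_dual_quad_iff[OF s] by blast
    \<comment> \<open>The tie could involve a vertex of another triangle; then the largest
      coordinate in \<tau> would be 0, but the coordinates sum to 1.\<close>
    have "\<xi> \<in> vertices \<tau>"
    proof (rule ccontr)
      assume "\<xi> \<notin> vertices \<tau>"
      then have "nodal \<tau> z x \<le> 0"
        using ge nodal_not_vertex[OF s(1)] by simp
      then have "nodal \<tau> \<eta> x = 0" for \<eta>
        using le[of \<eta>] by linarith
      then show False
        using nodal_expansion(1)[OF s(1), of x] by simp
    qed
    moreover from this have "x \<in> closed_segment (barycenter \<tau>) (midpoint z \<xi>)"
      using le ge \<xi>(1) by (auto simp: mem_dual_segment_iff[OF s] intro: antisym)
    ultimately show "x \<in> ?S"
      using \<tau>(1) \<xi>(1) by blast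
  qed
  show "?S \<subseteq> frontier ?C"
  proof
    fix x assume "x \<in> ?S"
    then obtain \<tau> \<eta> where \<tau>: "\<tau> \<in> star" and \<eta>: "\<eta> \<in> vertices \<tau>" "\<eta> \<noteq> z"
      and x: "x \<in> closed_segment (barycenter \<tau>) (midpoint z \<eta>)"
      by blast
    note s = starD(3,2)[OF \<tau>]
    have le: "nodal \<tau> z x = nodal \<tau> \<eta> x" "\<And>\<xi>. 0 \<le> nodal \<tau> \<xi> x \<and> nodal \<tau> \<xi> x \<le> nodal \<tau> z x"
      using x unfolding mem_dual_segment_iff[OF s \<eta>] by blast+
    have "x \<in> ?C"
      using \<tau> le(2) mem_dual_quad_iff[OF s] unfolding control_volume_star by blast
    moreover have "x \<notin> interior ?C"
    proof
      assume "x \<in> interior ?C"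
      then obtain r where r: "r > 0" "x + r *\<^sub>R (\<eta> - z) \<in> interior ?C"
        using small_translate[OF open_interior] by blast
      define y where "y = x + r *\<^sub>R (\<eta> - z)"
      have nod: "nodal \<tau> \<xi> y = nodal \<tau> \<xi> x + r * ((if \<xi> = \<eta> then 1 else 0) - (if \<xi> = z then 1 else 0))" for \<xi>
        unfolding y_def nodal_translate[OF s(1)] using s(2) \<eta>(1) by (simp add: nodal_props(2)[OF s(1)])
      \<comment> \<open>The shift lowers only the coordinate of \<open>z\<close>, which the cone
        does not restrict.\<close>
      have y: "y \<in> corner_cone \<tau>"
        using le(2) r(1) by (auto simp: corner_cone_def nod add_nonneg_nonneg)
      have "y \<in> ?C"
        using r(2) interior_subset by (auto simp: y_def)
      moreover have "\<eta> \<in> star_vertices - {z}"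
        using \<tau> \<eta> by (auto simp: star_vertices_def)
      ultimately have "coord \<eta> y \<le> coord z y"
        unfolding mem_control_volume_iff by blast
      then show False
        using r(1) \<eta>(2) le(1) unfolding coord_eq[OF \<tau> y] nod by simp
    qed
    ultimately show "x \<in> frontier ?C"
      using closure_subset by (auto simp: frontier_def)
  qed
qed

text \<open>The intersection is a face of \<tau>. A proper face misses the interior, and if it were
  all of \<tau>, then \<tau> would be a proper face of \<open>\<tau>'\<close> of the same
  dimension.\<close>

lemma interior_disjoint:
  assumes "\<tau> \<in> T" "\<tau>' \<in> T" "\<tau> \<noteq> \<tau>'" "x \<in> interior \<tau>"
  shows "x \<notin> \<tau>'"
proof -
  have "\<tau> \<inter> \<tau>' \<noteq> \<tau>"
  proof
    assume "\<tau> \<inter> \<tau>' = \<tau>"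
    then have "\<tau> face_of \<tau>'"
      using face_of_Int_T[OF assms(2,1)] by (simp add: Int_commute)
    then have "aff_dim \<tau> < aff_dim \<tau>'"
      using assms(3) convex_simplex[OF triangle[OF assms(2)]] by (intro face_of_aff_dim_lt)
    then show False
      using aff_dim_simplex[OF triangle[OF assms(1)]] aff_dim_simplex[OF triangle[OF assms(2)]] by simp
  qed
  then have "(\<tau> \<inter> \<tau>') \<inter> interior \<tau> = {}"
    by (intro face_of_disjoint_interior face_of_Int_T assms(1,2))
  then show ?thesis
    using assms(4) interior_subset by blast
qed

lemma control_volume_Int_interior:
  assumes "\<tau> \<in> star"
  shows "control_volume T z \<inter> interior \<tau> = dual_quad \<tau> z \<inter> interior \<tau>"
proof -
  have "\<tau>' = \<tau>" if "\<tau>' \<in> star" "x \<in> dual_quad \<tau>' z" "x \<in> interior \<tau>" for \<tau>' x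
    using that interior_disjoint[of \<tau> \<tau>' x] starD assms dual_quad_subset[of \<tau>' z] by blast
  then show ?thesis
    using assms unfolding control_volume_star by blast
qed

text \<open>Quadrilaterals of different elements meet only in frontiers of triangles, which are
  negligible.\<close>

lemma integral_control_volume:
  assumes "\<And>\<tau>. \<tau> \<in> star \<Longrightarrow> set_integrable lebesgue \<tau> f"
  shows "(LINT x:control_volume T z|lebesgue. f x) =
    (\<Sum>\<tau>\<in>star. LINT x:dual_quad \<tau> z|lebesgue. (f x :: real))"
  unfolding control_volume_star
proof (rule set_integral_finite_UN_AE[OF finite_star])
  fix \<tau> assume \<tau>: "\<tau> \<in> star"
  note s = starD(3,2)[OF \<tau>]
  show meas: "dual_quad \<tau> z \<in> sets lebesgue"
    using dual_quad_compact[OF s(1)] lmeasurable_compact by blast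
  show "set_integrable lebesgue (dual_quad \<tau> z) f"
    using assms[OF \<tau>] meas dual_quad_subset[OF s] by (rule set_integrable_subset)
  fix \<tau>' assume \<tau>': "\<tau>' \<in> star"
  have "negligible (frontier \<tau>)"
    using convex_simplex[OF s(1)] by (rule negligible_convex_frontier)
  then have "AE x in lebesgue. x \<notin> frontier \<tau>"
    by (simp add: AE_not_in negligible_iff_null_sets)
  then show "AE x in lebesgue. x \<in> dual_quad \<tau> z \<and> x \<in> dual_quad \<tau>' z \<longrightarrow> \<tau> = \<tau>'"
  proof eventually_elim
    case (elim x)
    show ?case
      using elim interior_disjoint[OF starD(1)[OF \<tau>] starD(1)[OF \<tau>'], of x] closure_subset
        dual_quad_subset[OF s] dual_quad_subset[OF starD(3,2)[OF \<tau>']]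
      by (auto simp: frontier_def)
  qed
qed

section \<open>Decomposition of the frontier into dual segments\<close>

definition dual_segments :: "point set \<Rightarrow> (point \<times> point) set" where
  "dual_segments \<tau> = (\<lambda>\<eta>. (barycenter \<tau>, midpoint z \<eta>)) ` (vertices \<tau> - {z})"

lemma barycenter_interior: "\<tau> \<in> T \<Longrightarrow> barycenter \<tau> \<in> interior \<tau>"
  using triangle by (auto intro!: mem_interior_triangle simp: nodal_barycenter)

text \<open>In one triangle all three coordinates tie at a common point, which is the barycenter.
  For different triangles only the edge midpoint can be shared, as the rest of each segment is
  interior to its triangle.\<close>

lemma dual_segments_Int:
  assumes "\<tau> \<in> star" "\<tau>' \<in> star" "(a, b) \<in> dual_segments \<tau>" "(c, d) \<in> dual_segments \<tau>'"
    and ne: "(a, b) \<noteq> (c, d)"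
  shows "finite (closed_segment a b \<inter> closed_segment c d)"
proof -
  obtain \<eta> where \<eta>: "\<eta> \<in> vertices \<tau>" "\<eta> \<noteq> z" and ab: "a = barycenter \<tau>" "b = midpoint z \<eta>"
    using assms(3) by (auto simp: dual_segments_def)
  obtain \<zeta> where \<zeta>: "\<zeta> \<in> vertices \<tau>'" "\<zeta> \<noteq> z" and cd: "c = barycenter \<tau>'" "d = midpoint z \<zeta>"
    using assms(4) by (auto simp: dual_segments_def)
  note s = starD(3,2)[OF assms(1)]
  note s' = starD(3,2)[OF assms(2)]
  show ?thesis
  proof (cases "\<tau> = \<tau>'")
    case True
    have "\<eta> \<noteq> \<zeta>"
      using ne by (auto simp: ab cd True)
    then obtain V: "vertices \<tau> = {z, \<eta>, \<zeta>}"
      using triangle_vertices_at[OF s \<eta>] \<zeta> True by (metis empty_iff insert_iff)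
    have "x = a" if "x \<in> closed_segment a b \<inter> closed_segment c d" for x
    proof (rule triangle_eqI[OF s(1)])
      have "nodal \<tau> z x = nodal \<tau> \<eta> x" "nodal \<tau> z x = nodal \<tau> \<zeta> x"
        using that mem_dual_segment_iff[OF s \<eta>, of x] mem_dual_segment_iff[OF s' \<zeta>, of x]
        by (auto simp: ab cd True)
      moreover from this have "3 * nodal \<tau> z x = 1"
        using nodal_expansion(1)[OF s(1), of x] \<open>\<eta> \<noteq> \<zeta>\<close> \<eta>(2) \<zeta>(2) by (simp add: V)
      ultimately show "nodal \<tau> \<xi> x = nodal \<tau> \<xi> a" if "\<xi> \<in> vertices \<tau>" for \<xi>
        using that by (auto simp: ab V nodal_barycenter[OF s(1)])
    qed
    then have "closed_segment a b \<inter> closed_segment c d \<subseteq> {a}"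
      by blast
    then show ?thesis
      by (rule finite_subset) simp
  next
    case False
    have "x = b" if "x \<in> closed_segment a b \<inter> closed_segment c d" for x
    proof (rule ccontr)
      assume "x \<noteq> b"
      then have "x \<in> interior \<tau>"
        using that dual_segment_interior[OF s \<eta>, of x] by (simp add: ab)
      moreover have "x \<in> \<tau>'"
        using that mem_dual_segment_iff[OF s' \<zeta>, of x] mem_triangle_iff[OF s'(1), of x]
        by (simp add: cd)
      ultimately show False
        using interior_disjoint[OF starD(1)[OF assms(1)] starD(1)[OF assms(2)] False] by blast
    qed
    then have "closed_segment a b \<inter> closed_segment c d \<subseteq> {b}"
      by blast
    then show ?thesis
      by (rule finite_subset) simp
  qed
qed

lemma has_line_integral_frontier:
  assumes "\<And>\<tau> \<eta>. \<tau> \<in> star \<Longrightarrow> \<eta> \<in> vertices \<tau> \<Longrightarrow> \<eta> \<noteq> z \<Longrightarrow>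
      segment_integrable (barycenter \<tau>) (midpoint z \<eta>) h"
  shows "has_line_integral h (\<Sum>\<tau>\<in>star. dual_boundary_integral \<tau> z h)
    (frontier (control_volume T z))"
  unfolding has_line_integral_def
proof (intro exI[of _ "\<Union>\<tau>\<in>star. dual_segments \<tau>"] conjI)
  have fin: "finite (dual_segments \<tau>)" if "\<tau> \<in> star" for \<tau>
    using triangle_vertices(1)[OF starD(3)[OF that]] by (simp add: dual_segments_def)
  then show "finite (\<Union>\<tau>\<in>star. dual_segments \<tau>)"
    using finite_star by blast
  show "\<forall>(a, b) \<in> \<Union>\<tau>\<in>star. dual_segments \<tau>. a \<noteq> b \<and> segment_integrable a b h"
    using assms dual_segment_nondegenerate[OF starD(3,2)] by (auto simp: dual_segments_def)
  show "\<forall>(a, b) \<in> \<Union>\<tau>\<in>star. dual_segments \<tau>. \<forall>(c, d) \<in> \<Union>\<tau>\<in>star. dual_segments \<tau>.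
      (a, b) \<noteq> (c, d) \<longrightarrow> finite (closed_segment a b \<inter> closed_segment c d)"
    using dual_segments_Int by blast
  show "frontier (control_volume T z) = (\<Union>(a, b) \<in> \<Union>\<tau>\<in>star. dual_segments \<tau>. closed_segment a b)"
    unfolding frontier_control_volume dual_segments_def by auto
  \<comment> \<open>The first endpoints are barycenters, which differ for different elements, so the
    sum over the union counts nothing twice.\<close>
  have disj: "\<forall>\<tau>\<in>star. \<forall>\<tau>'\<in>star. \<tau> \<noteq> \<tau>' \<longrightarrow> dual_segments \<tau> \<inter> dual_segments \<tau>' = {}"
  proof (intro ballI impI)
    fix \<tau> \<tau>' assume *: "\<tau> \<in> star" "\<tau>' \<in> star" "\<tau> \<noteq> \<tau>'"
    have "barycenter \<tau> \<noteq> barycenter \<tau>'"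
      using interior_disjoint[of \<tau> \<tau>'] barycenter_interior[of \<tau>] barycenter_interior[of \<tau>']
        * starD(1) interior_subset by (metis subsetD)
    then show "dual_segments \<tau> \<inter> dual_segments \<tau>' = {}"
      by (auto simp: dual_segments_def)
  qed
  have "(\<Sum>(a, b)\<in>(\<Union>\<tau>\<in>star. dual_segments \<tau>). segment_integral a b h) =
      (\<Sum>\<tau>\<in>star. \<Sum>(a, b)\<in>dual_segments \<tau>. segment_integral a b h)"
    using finite_star fin disj by (intro sum.UNION_disjoint) auto
  also have "\<dots> = (\<Sum>\<tau>\<in>star. dual_boundary_integral \<tau> z h)"
  proof (rule sum.cong[OF refl])
    fix \<tau> assume "\<tau> \<in> star"
    have "inj_on (\<lambda>\<eta>. (barycenter \<tau>, midpoint z \<eta>)) (vertices \<tau> - {z})"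
      by (auto simp: inj_on_def midpoint_def)
    then show "(\<Sum>(a, b)\<in>dual_segments \<tau>. segment_integral a b h) = dual_boundary_integral \<tau> z h"
      unfolding dual_segments_def dual_boundary_integral_def by (subst sum.reindex) auto
  qed
  finally show "(\<Sum>\<tau>\<in>star. dual_boundary_integral \<tau> z h) =
      (\<Sum>(a, b)\<in>(\<Union>\<tau>\<in>star. dual_segments \<tau>). segment_integral a b h)" ..
qed

section \<open>The hat function as a test function\<close>

definition hat :: "point \<Rightarrow> real" where
  "hat y = max 0 (coord z y)"

lemma hat_star:
  assumes "\<tau> \<in> star" "y \<in> \<tau>"
  shows "hat y = nodal \<tau> z y"
proof -
  have "0 \<le> nodal \<tau> z y"
    using assms mem_triangle_iff[OF starD(3)] by blast
  then show ?thesis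
    using coord_eq[of \<tau> y z] subset_cone[OF assms(1)] assms by (auto simp: hat_def)
qed

text \<open>In a cone the other coordinates are non-negative anyway, so a positive coordinate of
  \<open>z\<close> puts the point into the triangle.\<close>

lemma coord_pos_mem:
  assumes "0 < coord z y"
  obtains \<tau> where "\<tau> \<in> star" "y \<in> \<tau>" "nodal \<tau> z y = coord z y"
proof -
  obtain \<tau> where \<tau>: "\<tau> \<in> star" "y \<in> corner_cone \<tau>"
    using cone_cover by blast
  have "0 \<le> nodal \<tau> \<eta> y" for \<eta>
    using \<tau>(2) assms coord_eq[OF \<tau>, of z] by (cases "\<eta> = z") (auto simp: corner_cone_def)
  then show thesis
    using \<tau> coord_eq[OF \<tau>] by (intro that) (auto simp: mem_triangle_iff[OF starD(3)[OF \<tau>(1)]])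
qed

text \<open>Where \<open>hat\<close> is positive, the point also lies in an element of the star;
  \<open>nodal_agree\<close> would then make \<open>nodal \<tau> z\<close> positive, although
  \<open>z\<close> is not a vertex of \<tau>.\<close>

lemma hat_not_star:
  assumes "\<tau> \<in> T" "\<tau> \<notin> star" "y \<in> \<tau>"
  shows "hat y = 0"
proof (rule ccontr)
  assume "hat y \<noteq> 0"
  then have pos: "0 < coord z y"
    by (auto simp: hat_def split: if_splits)
  then obtain \<tau>' where \<tau>': "\<tau>' \<in> star" "y \<in> \<tau>'" "nodal \<tau>' z y = coord z y"
    by (rule coord_pos_mem)
  have "nodal \<tau> z y = coord z y"
    using nodal_agree[OF assms(1) starD(1)[OF \<tau>'(1)] assms(3) \<tau>'(2)] \<tau>'(3) by simp
  then show False
    using pos nodal_not_vertex[OF triangle[OF assms(1)], of z y] assms(1,2) by (simp add: star_def)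
qed

lemma hat_zero_outside:
  assumes "y \<notin> interior (\<Union>T)"
  shows "hat y = 0"
proof (rule ccontr)
  assume "hat y \<noteq> 0"
  then have "y \<in> {y. 0 < coord z y}"
    by (auto simp: hat_def split: if_splits)
  moreover have "open {y. 0 < coord z y}"
    by (intro open_Collect_less coord_continuous continuous_intros)
  moreover have "{y. 0 < coord z y} \<subseteq> \<Union>T"
  proof
    fix x assume "x \<in> {y. 0 < coord z y}"
    then obtain \<tau> where "\<tau> \<in> star" "x \<in> \<tau>"
      using coord_pos_mem[of x] by blast
    then show "x \<in> \<Union>T"
      using starD(1) by blast
  qed
  ultimately show False
    using assms interior_maximal by blast
qed

lemma hat_continuous: "continuous_on S hat"
proof -
  have "continuous_on UNIV hat"
    unfolding hat_def by (intro continuous_on_max coord_continuous continuous_intros)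
  then show ?thesis
    by (rule continuous_on_subset) simp
qed

lemma hat_linear_on_elem:
  assumes "\<tau> \<in> T"
  shows "linear_on_elem \<tau> hat"
proof (cases "\<tau> \<in> star")
  case True
  then show ?thesis
    using nodal_props(1)[OF starD(3)[OF True], of z] by (auto simp: linear_on_elem_def hat_star)
next
  case False
  then show ?thesis
    using hat_not_star[OF assms] unfolding linear_on_elem_def
    by (intro exI[of _ 0] ballI) simp
qed

text \<open>Reduces the global form tested with \<open>hat\<close> to the terms of the Neumann
  problems at \<open>z\<close>.\<close>

lemma sum_a_elem_hat:
  "(\<Sum>\<tau>\<in>T. a_elem \<delta> k v \<tau> u hat) = (\<Sum>\<tau>\<in>star. a_elem \<delta> k v \<tau> u (nodal \<tau> z))"
proof -
  have "a_elem \<delta> k v \<tau> u hat = 0" if "\<tau> \<in> T - star" for \<tau>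
    using that a_elem_cong[OF convex_simplex[OF triangle], of \<tau> hat "\<lambda>x. 0"] hat_not_star[of \<tau>] by simp
  moreover have "a_elem \<delta> k v \<tau> u hat = a_elem \<delta> k v \<tau> u (nodal \<tau> z)" if "\<tau> \<in> star" for \<tau>
    using that convex_simplex[OF starD(3)] by (intro a_elem_cong) (auto simp: hat_star)
  ultimately show ?thesis
    using finite_T by (intro sum.mono_neutral_cong_right) (auto simp: star_def)
qed

lemma sum_l_elem_hat:
  "(\<Sum>\<tau>\<in>T. l_elem \<delta> v f \<tau> hat) = (\<Sum>\<tau>\<in>star. l_elem \<delta> v f \<tau> (nodal \<tau> z))"
proof -
  have "l_elem \<delta> v f \<tau> hat = 0" if "\<tau> \<in> T - star" for \<tau>
    using that l_elem_cong[OF convex_simplex[OF triangle], of \<tau> hat "\<lambda>x. 0"] hat_not_star[of \<tau>] by simp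
  moreover have "l_elem \<delta> v f \<tau> hat = l_elem \<delta> v f \<tau> (nodal \<tau> z)" if "\<tau> \<in> star" for \<tau>
    using that convex_simplex[OF starD(3)] by (intro l_elem_cong) (auto simp: hat_star)
  ultimately show ?thesis
    using finite_T by (intro sum.mono_neutral_cong_right) (auto simp: star_def)
qed

end

section \<open>Local conservation\<close>

theorem lemma3p2:
  fixes \<Omega> :: "(real^2) set"
    and T :: "(real^2) set set"
    and k f g g\<^sub>h u\<^sub>h :: "real^2 \<Rightarrow> real"
    and v \<nu> :: "real^2 \<Rightarrow> real^2"
    and \<delta> :: real
    and z :: "real^2"
    and u\<^sub>\<tau> :: "(real^2) set \<Rightarrow> real^2 \<Rightarrow> real"
  assumes "polygonal_lipschitz_domain \<Omega>"
    and "coefficient_assumptions \<Omega> k v"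
    and "conforming_triangulation T \<Omega>"
    and "\<delta> \<ge> 0"
    and "integrals_exist \<delta> k v f T"
    and "interpolant T \<Omega> g g\<^sub>h"
    and "supg_solution \<delta> k v f T \<Omega> g\<^sub>h u\<^sub>h"
    and "interior_vertex T \<Omega> z"
    and "\<And>\<tau>. \<tau> \<in> T \<Longrightarrow> z \<in> vertices \<tau> \<Longrightarrow> neumann_solution \<delta> k v f u\<^sub>h \<tau> (u\<^sub>\<tau> \<tau>)"
    and "\<And>\<tau> x. \<tau> \<in> T \<Longrightarrow> z \<in> vertices \<tau> \<Longrightarrow> x \<in> interior \<tau> \<Longrightarrow>
           \<nu> x = - (k x *\<^sub>R grad (u\<^sub>\<tau> \<tau>) x) + u\<^sub>h x *\<^sub>R v x"
  shows "has_line_integral (\<lambda>x. \<nu> x \<bullet> outward_normal (control_volume T z) x)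
           (LINT x:control_volume T z|lebesgue. f x)
           (frontier (control_volume T z))"
proof -
  have T: "triangulation T" "\<And>\<tau>. \<tau> \<in> T \<Longrightarrow> 2 simplex \<tau>" "\<Union>T = closure \<Omega>"
    using assms(3) by (auto simp: conforming_triangulation_def)
  have \<Omega>: "open \<Omega>" "lipschitz_boundary \<Omega>"
    using assms(1) by (auto simp: polygonal_lipschitz_domain_def)
  have z: "z \<in> \<Omega>" "\<exists>\<tau>\<in>T. z \<in> vertices \<tau>"
    using assms(8) by (auto simp: interior_vertex_def)
  have "\<Omega> \<subseteq> interior (\<Union>T)"
    unfolding T(3) using \<Omega>(1) closure_subset by (rule interior_maximal[rotated])
  then interpret vertex_star T z
    using T(1,2) z by unfold_locales auto
  let ?n = "outward_normal (control_volume T z)"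
  let ?h = "\<lambda>x. \<nu> x \<bullet> ?n x"
  let ?diff = "\<lambda>\<tau> x. (k x *\<^sub>R grad (u\<^sub>\<tau> \<tau>) x) \<bullet> outward_normal (dual_quad \<tau> z) x"
  let ?conv = "\<lambda>\<tau> x. (u\<^sub>h x *\<^sub>R v x) \<bullet> outward_normal (dual_quad \<tau> z) x"

  have hat: "hat \<in> V\<^sub>h T \<Omega>"
  proof -
    have "hat x = 0" if "x \<in> frontier \<Omega>" for x
    proof (rule hat_zero_outside)
      have "x \<notin> \<Omega>"
        using that \<Omega>(1) by (simp add: frontier_def interior_open)
      then show "x \<notin> interior (\<Union>T)"
        unfolding T(3) using interior_closure_lipschitz_subset[OF \<Omega>(2)] by blast
    qed
    then show ?thesis
      by (simp add: V\<^sub>h_def piecewise_linear_def hat_continuous hat_linear_on_elem)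
  qed

  have u\<^sub>h_linear: "linear_on_elem \<tau> u\<^sub>h" if "\<tau> \<in> T" for \<tau>
  proof -
    have "linear_on_elem \<tau> (\<lambda>x. u\<^sub>h x - g\<^sub>h x)" "linear_on_elem \<tau> g\<^sub>h"
      using assms(6,7) that
      by (simp_all add: supg_solution_def V\<^sub>h_def interpolant_def piecewise_linear_def)
    then obtain a b c d where "\<forall>x\<in>\<tau>. u\<^sub>h x - g\<^sub>h x = a \<bullet> x + b" "\<forall>x\<in>\<tau>. g\<^sub>h x = c \<bullet> x + d"
      unfolding linear_on_elem_def by (elim exE)
    then have "u\<^sub>h x = (a + c) \<bullet> x + (b + d)" if "x \<in> \<tau>" for x
      using that by (fastforce simp: inner_add_left)
    then show ?thesis
      unfolding linear_on_elem_def by blast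
  qed

  have flux: "segment_integrable (barycenter \<tau>) (midpoint z \<eta>) ?h \<and>
      segment_integral (barycenter \<tau>) (midpoint z \<eta>) ?h =
        - segment_integral (barycenter \<tau>) (midpoint z \<eta>) (?diff \<tau>) +
        segment_integral (barycenter \<tau>) (midpoint z \<eta>) (?conv \<tau>)"
    if \<tau>: "\<tau> \<in> star" and \<eta>: "\<eta> \<in> vertices \<tau>" "\<eta> \<noteq> z" for \<tau> \<eta>
  proof -
    note s = starD(3,2)[OF \<tau>]
    let ?a = "barycenter \<tau>" and ?b = "midpoint z \<eta>"
    have ne: "?a \<noteq> ?b"
      using dual_segment_nondegenerate[OF s \<eta>] .
    have exist: "segment_integrable ?a ?b (\<lambda>x. (k x *\<^sub>R grad p x) \<bullet> outward_normal (dual_quad \<tau> z) x)"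
      "segment_integrable ?a ?b (\<lambda>x. (p x *\<^sub>R v x) \<bullet> outward_normal (dual_quad \<tau> z) x)"
      if "p \<in> V_elem \<tau>" for p
      using assms(5) starD(1,2)[OF \<tau>] \<eta> that
      unfolding integrals_exist_def dual_boundary_integrable_def by blast+
    have "u\<^sub>\<tau> \<tau> \<in> V_elem \<tau>"
      using assms(9)[OF starD(1,2)[OF \<tau>]] by (simp add: neumann_solution_def)
    then have diff: "segment_integrable ?a ?b (?diff \<tau>)"
      by (rule exist(1))
    \<comment> \<open>Integrability is assumed for members of \<open>V_elem \<tau>\<close> only, so
      \<open>u\<^sub>h\<close> is replaced by the affine function that agrees with it on
      \<tau>.\<close>
    obtain p where p: "p \<in> V_elem \<tau>" "\<And>x. x \<in> \<tau> \<Longrightarrow> p x = u\<^sub>h x"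
      using linear_on_elem_V_elem[OF s(1) u\<^sub>h_linear[OF starD(1)[OF \<tau>]]] by blast
    have conv: "segment_integrable ?a ?b (?conv \<tau>)"
      using exist(2)[OF p(1)]
    proof (rule segment_integrable_spike)
      show "?conv \<tau> x = (p x *\<^sub>R v x) \<bullet> outward_normal (dual_quad \<tau> z) x"
        if "x \<in> closed_segment ?a ?b - {?b}" for x
        using that p(2) dual_segment_interior[OF s \<eta>, of x] interior_subset[of \<tau>] by auto
    qed (rule ne)
    \<comment> \<open>Away from the edge midpoint the segment is interior to \<tau>, where the
      formula for \<nu> applies and the control volume coincides with the quadrilateral.\<close>
    have eq: "?h x = - ?diff \<tau> x + ?conv \<tau> x" if "x \<in> closed_segment ?a ?b - {?b}" for x
    proof -
      have x: "x \<in> interior \<tau>"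
        using that dual_segment_interior[OF s \<eta>, of x] by blast
      then have "?n x = outward_normal (dual_quad \<tau> z) x"
        using control_volume_Int_interior[OF \<tau>] by (intro outward_normal_cong[of "interior \<tau>"]) auto
      then show ?thesis
        using assms(10)[OF starD(1,2)[OF \<tau>] x] by (simp add: inner_add_left inner_diff_left)
    qed
    note minus = segment_integral_minus[OF diff]
    note add = segment_integral_add[OF minus(1) conv]
    show ?thesis
      using segment_integrable_spike[OF add(1) eq ne] segment_integral_spike[OF eq ne]
        minus(2) add(2) by simp
  qed

  have "dual_boundary_integral \<tau> z ?h =
      a_elem \<delta> k v \<tau> u\<^sub>h (nodal \<tau> z) - l_elem \<delta> v f \<tau> (nodal \<tau> z) + (LINT x:dual_quad \<tau> z|lebesgue. f x)"
    if \<tau>: "\<tau> \<in> star" for \<tau>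
  proof -
    have "dual_boundary_integral \<tau> z ?h =
        - dual_boundary_integral \<tau> z (?diff \<tau>) + dual_boundary_integral \<tau> z (?conv \<tau>)"
      using flux[OF \<tau>] by (simp add: dual_boundary_integral_def sum.distrib sum_subtractf)
    moreover have "- dual_boundary_integral \<tau> z (?diff \<tau>) =
        a_elem \<delta> k v \<tau> u\<^sub>h (nodal \<tau> z) - l_elem \<delta> v f \<tau> (nodal \<tau> z) +
        (LINT x:dual_quad \<tau> z|lebesgue. f x) - dual_boundary_integral \<tau> z (?conv \<tau>)"
      using assms(9)[OF starD(1,2)[OF \<tau>]] starD(2)[OF \<tau>] unfolding neumann_solution_def by blast
    ultimately show ?thesis
      by linarith
  qed
  then have "(\<Sum>\<tau>\<in>star. dual_boundary_integral \<tau> z ?h) =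
      (\<Sum>\<tau>\<in>T. a_elem \<delta> k v \<tau> u\<^sub>h hat) - (\<Sum>\<tau>\<in>T. l_elem \<delta> v f \<tau> hat) +
      (\<Sum>\<tau>\<in>star. LINT x:dual_quad \<tau> z|lebesgue. f x)"
    by (simp add: sum_a_elem_hat sum_l_elem_hat sum.distrib sum_subtractf)
  \<comment> \<open>The discrete equation tested with \<open>hat\<close> cancels the first two
    sums.\<close>
  also have "\<dots> = (\<Sum>\<tau>\<in>star. LINT x:dual_quad \<tau> z|lebesgue. f x)"
    using assms(7) hat by (simp add: supg_solution_def)
  also have "\<dots> = (LINT x:control_volume T z|lebesgue. f x)"
    using assms(5) starD(1) by (intro integral_control_volume[symmetric]) (auto simp: integrals_exist_def)
  finally show ?thesis
    using has_line_integral_frontier[of ?h] flux by simp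
qed

end
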